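(* Let $n,m\geq1$ be integers with $n+m\geq3$, $d=m+n$, and let $\Theta$ be a real $n\times m$ matrix. Suppose that the set of integer solutions $(\vec x,\vec y)\in\mathbb Z^m\oplus\mathbb Z^n$ of $\Theta\vec x=\vec y$ is not a one-dimensional lattice. Then, with the Schmidt exponents $\underline\Psi_1,\overline\Psi_1,\underline\Psi_2$ defined in the context, \[ \underline\Psi_2\leq 2\underline\Psi_1+d\cdot\frac{\overline\Psi_1-\underline\Psi_1}{n+n\overline\Psi_1}\quad\text{if }\overline\Psi_1\neq-1, \] and \[ \underline\Psi_2\leq 2\underline\Psi_1+d\cdot\frac{\overline\Psi_1-\underline\Psi_1}{m-n\overline\Psi_1}\,. \]
   Context: Let $\Lambda=\{(\vec x,\ \vec y-\Theta\vec x)\in\mathbb R^m\times\mathbb R^n:\ \vec x\in\mathbb Z^m,\ \vec y\in\mathbb Z^n\}$, a unimodular lattice in $\mathbb R^d$. For $s>0$ let $\mathcal B(s)=\{\vec z\in\mathbb R^d:\ |z_i|\le e^{s}\ (1\le i\le m),\ |z_i|\le e^{-ms/n}\ (m<i\le d)\}$. For $p=1,\ldots,d$ let $\lambda_p(\mathcal B(s))$ be the $p$-th successive minimum of $\mathcal B(s)$ with respect to $\Lambda$ (the infimum of $\lambda>0$ such that $\lambda\mathcal B(s)$ contains $p$ linearly independent points of $\Lambda$), $\psi_p(s)=\ln(\lambda_p(\mathcal B(s)))/s$, and $\Psi_p(s)=\sum_{i=1}^p\psi_i(s)$. The lower and upper Schmidt exponents are $\underline\Psi_p=\liminf_{s\to+\infty}\Psi_p(s)$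 and $\overline\Psi_p=\limsup_{s\to+\infty}\Psi_p(s)$. *)

theory Defs
  imports "HOL-Analysis.Analysis"
begin

text \<open>
  Points of \<open>\<real>\<^sup>d\<close>, with \<open>d = m + n\<close>, are pairs in \<open>\<real>\<^sup>m \<times> \<real>\<^sup>n\<close>, where \<open>m = CARD('m)\<close> and
  \<open>n = CARD('n)\<close>. A real \<open>n \<times> m\<close> matrix has type \<^typ>\<open>real^'m^'n\<close>.
\<close>

definition int_vec :: "(real^'k) set"
  where "int_vec = {x. \<forall>i. x $ i \<in> \<int>}"

definition lattice_of :: "real^'m^'n \<Rightarrow> ((real^'m) \<times> (real^'n)) set"
  where "lattice_of \<Theta> = {(x, y - \<Theta> *v x) | x y. x \<in> int_vec \<and> y \<in> int_vec}"

definition pbox :: "real \<Rightarrow> ((real^'m) \<times> (real^'n)) set"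
  where "pbox s = {(u, v). (\<forall>i. \<bar>u $ i\<bar> \<le> exp s) \<and>
                          (\<forall>j. \<bar>v $ j\<bar> \<le> exp (- (real CARD('m) * s / real CARD('n))))}"

definition succ_min :: "nat \<Rightarrow> 'a::real_vector set \<Rightarrow> 'a set \<Rightarrow> real"
  where "succ_min p K L =
    Inf {\<mu>. \<mu> > 0 \<and> (\<exists>S. S \<subseteq> L \<inter> (\<lambda>z. \<mu> *\<^sub>R z) ` K \<and> finite S \<and> card S = p \<and> independent S)}"

definition psi :: "real^'m^'n \<Rightarrow> nat \<Rightarrow> real \<Rightarrow> real"
  where "psi \<Theta> p s = ln (succ_min p (pbox s) (lattice_of \<Theta>)) / s"

definition Psi :: "real^'m^'n \<Rightarrow> nat \<Rightarrow> real \<Rightarrow> real"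
  where "Psi \<Theta> p s = (\<Sum>i=1..p. psi \<Theta> i s)"

text \<open>The exponents are finite for every \<open>\<Theta>\<close>; \<^typ>\<open>ereal\<close> is used because
  \<^const>\<open>Liminf\<close> and \<^const>\<open>Limsup\<close> need a complete lattice.\<close>

definition lower_schmidt :: "real^'m^'n \<Rightarrow> nat \<Rightarrow> ereal"
  where "lower_schmidt \<Theta> p = Liminf at_top (\<lambda>s. ereal (Psi \<Theta> p s))"

definition upper_schmidt :: "real^'m^'n \<Rightarrow> nat \<Rightarrow> ereal"
  where "upper_schmidt \<Theta> p = Limsup at_top (\<lambda>s. ereal (Psi \<Theta> p s))"

definition int_solutions :: "real^'m^'n \<Rightarrow> ((real^'m) \<times> (real^'n)) set"
  where "int_solutions \<Theta> = {(x, y). x \<in> int_vec \<and> y \<in> int_vec \<and> \<Theta> *v x = y}"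

definition is_lattice_of_dim :: "nat \<Rightarrow> 'a::real_vector set \<Rightarrow> bool"
  where "is_lattice_of_dim k L \<longleftrightarrow>
    (\<exists>B. finite B \<and> card B = k \<and> independent B \<and>
         L = {\<Sum>b\<in>B. of_int (c b) *\<^sub>R b | c :: 'a \<Rightarrow> int. True})"

end

theory Submission
  imports Defs
begin

text \<open>
  Write \<open>\<kappa> = m/n\<close>, \<open>\<psi> = \<psi>\<^sub>1\<close>, and let \<open>N\<^sub>s\<close> be the gauge of \<open>\<B>(s)\<close>, so that \<open>N\<^sub>s(u, v)\<close> is the maximum of
  \<open>\<bar>u\<bar> e\<^sup>-\<^sup>s\<close> and \<open>\<bar>v\<bar> e\<^sup>\<kappa>\<^sup>s\<close>. Suppose that \<open>\<Theta> x = y\<close> has no nonzero integer solution. A lattice point \<open>z\<close>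
  nearly realising \<open>\<lambda>\<^sub>1\<close> at a time where \<open>\<psi>\<close> is close to its lower limit \<open>a\<close> has a time \<open>\<sigma>\<close> at which the two terms
  balance, and moving to \<open>\<sigma>\<close> does not increase \<open>ln N\<^sub>\<sigma>(z) / \<sigma>\<close>. From \<open>\<sigma>\<close> the function \<open>ln N\<^sub>t(z)\<close> grows with
  slope \<open>\<kappa>\<close> forwards and with slope \<open>1\<close> backwards, so in both directions there is a time \<open>t\<close> at which it
  reaches \<open>b' t\<close>, where \<open>b'\<close> is slightly larger than the upper limit \<open>b\<close> of \<open>\<psi>\<close>. At that time some lattice
  point \<open>w\<close> is shorter than \<open>z\<close>, hence independent of \<open>z\<close>, and carrying \<open>w\<close> back to \<open>\<sigma>\<close> bounds the second
  minimum there. The forward time gives the bound with denominator \<open>m - n b\<close>, the backward time the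
  one with \<open>n + n b\<close>. If the integer solutions have rank at least two, \<open>\<psi>\<^sub>1\<close> and \<open>\<psi>\<^sub>2\<close>
  both tend to \<open>-1\<close>.
\<close>

section \<open>The gauge of the boxes\<close>

lemma infnorm_le_iff_cart: "infnorm (x :: real^'k) \<le> r \<longleftrightarrow> (\<forall>i. \<bar>x $ i\<bar> \<le> r)"
proof
  assume "infnorm x \<le> r"
  then show "\<forall>i. \<bar>x $ i\<bar> \<le> r"
    using component_le_infnorm_cart order_trans by blast
next
  assume "\<forall>i. \<bar>x $ i\<bar> \<le> r"
  then show "infnorm x \<le> r"
    unfolding infnorm_cart by (intro cSup_least) auto
qed

definition pbox_gauge :: "real \<Rightarrow> (real^'m) \<times> (real^'n) \<Rightarrow> real"
  where "pbox_gauge s z =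
    max (infnorm (fst z) * exp (- s)) (infnorm (snd z) * exp (real CARD('m) / real CARD('n) * s))"

lemma mem_pbox_iff:
  fixes z :: "(real^'m) \<times> (real^'n)"
  shows "z \<in> pbox s \<longleftrightarrow> pbox_gauge s z \<le> 1"
proof (cases z)
  case (Pair u v)
  have "infnorm u * exp (- s) \<le> 1 \<longleftrightarrow> infnorm u \<le> exp s"
    by (simp add: exp_minus divide_simps)
  moreover have "infnorm v * exp (real CARD('m) / real CARD('n) * s) \<le> 1
      \<longleftrightarrow> infnorm v \<le> exp (- (real CARD('m) * s / real CARD('n)))"
    by (simp add: exp_minus divide_simps)
  ultimately show ?thesis
    using Pair by (simp add: pbox_def pbox_gauge_def infnorm_le_iff_cart)
qed

lemma pbox_gauge_scaleR: "pbox_gauge s (c *\<^sub>R z) = \<bar>c\<bar> * pbox_gauge s z"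
  by (simp add: pbox_gauge_def infnorm_mul max_mult_distrib_left mult.assoc)

lemma mem_scaled_pbox_iff:
  fixes z :: "(real^'m) \<times> (real^'n)"
  assumes "\<mu> > 0"
  shows "z \<in> (\<lambda>z. \<mu> *\<^sub>R z) ` pbox s \<longleftrightarrow> pbox_gauge s z \<le> \<mu>"
proof -
  have "z \<in> (\<lambda>z. \<mu> *\<^sub>R z) ` pbox s \<longleftrightarrow> inverse \<mu> *\<^sub>R z \<in> pbox s"
    using assms by (force simp: image_iff)
  also have "\<dots> \<longleftrightarrow> pbox_gauge s z \<le> \<mu>"
    using assms by (simp add: mem_pbox_iff pbox_gauge_scaleR divide_simps)
  finally show ?thesis .
qed

text \<open>Going back from \<open>t\<close> to \<open>s\<close> multiplies the first term of the
  maximum by exactly \<open>exp (t - s)\<close>, while the second term does not increase.\<close>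

lemma pbox_gauge_backward:
  fixes z :: "(real^'m) \<times> (real^'n)"
  assumes "s \<le> t"
  shows "pbox_gauge s z \<le> exp (t - s) * pbox_gauge t z"
proof -
  have "exp (real CARD('m) / real CARD('n) * s) \<le> exp (t - s) * exp (real CARD('m) / real CARD('n) * t)"
    using assms mult_left_mono[OF assms, of "real CARD('m) / real CARD('n)"]
    unfolding exp_add[symmetric] exp_le_cancel_iff by simp
  then have "infnorm (snd z) * exp (real CARD('m) / real CARD('n) * s)
      \<le> infnorm (snd z) * (exp (t - s) * exp (real CARD('m) / real CARD('n) * t))"
    by (rule mult_left_mono) (rule infnorm_pos_le)
  moreover have "infnorm (fst z) * exp (- s) = exp (t - s) * (infnorm (fst z) * exp (- t))"
    by (simp add: mult_exp_exp algebra_simps)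
  moreover have "exp (t - s) * max x y = max (exp (t - s) * x) (exp (t - s) * y)" for x y :: real
    by (simp add: max_mult_distrib_left)
  ultimately show ?thesis
    unfolding pbox_gauge_def by (simp only: mult.left_commute)
qed

text \<open>Here the second term is multiplied by exactly the stated factor, and the first term does
  not increase.\<close>

lemma pbox_gauge_forward:
  fixes z :: "(real^'m) \<times> (real^'n)"
  assumes "s \<le> t"
  shows "pbox_gauge t z \<le> exp (real CARD('m) / real CARD('n) * (t - s)) * pbox_gauge s z"
proof -
  define \<kappa> where "\<kappa> = real CARD('m) / real CARD('n)"
  have "exp (- t) \<le> exp (\<kappa> * (t - s)) * exp (- s)"
    using assms mult_left_mono[OF assms, of \<kappa>]
    unfolding exp_add[symmetric] exp_le_cancel_iff by (simp add: \<kappa>_def right_diff_distrib)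
  then have "infnorm (fst z) * exp (- t) \<le> infnorm (fst z) * (exp (\<kappa> * (t - s)) * exp (- s))"
    by (rule mult_left_mono) (rule infnorm_pos_le)
  moreover have "infnorm (snd z) * exp (\<kappa> * t) = exp (\<kappa> * (t - s)) * (infnorm (snd z) * exp (\<kappa> * s))"
    by (simp add: mult_exp_exp algebra_simps)
  moreover have "exp (\<kappa> * (t - s)) * max x y
      = max (exp (\<kappa> * (t - s)) * x) (exp (\<kappa> * (t - s)) * y)" for x y :: real
    by (simp add: max_mult_distrib_left)
  ultimately show ?thesis
    unfolding pbox_gauge_def \<kappa>_def[symmetric]
    by (simp only: mult.left_commute)
qed

section \<open>Lower bounds for the gauge at lattice points\<close>

lemma infnorm_int_vec_ge_1:
  assumes "x \<in> int_vec" "x \<noteq> 0"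
  shows "infnorm x \<ge> 1"
proof -
  obtain i where "x $ i \<noteq> 0"
    using assms(2) by (auto simp: vec_eq_iff)
  moreover have "x $ i \<in> \<int>"
    using assms(1) by (simp add: int_vec_def)
  ultimately have "\<bar>x $ i\<bar> \<ge> 1"
    by (rule Ints_nonzero_abs_ge1[rotated])
  then show ?thesis
    using component_le_infnorm_cart order_trans by blast
qed

text \<open>When the first component vanishes, so does the contribution of \<Theta>, and the second
  component is a nonzero integer vector.\<close>

lemma pbox_gauge_ge_exp_if_fst_0:
  fixes z :: "(real^'m) \<times> (real^'n)"
  assumes "z \<in> lattice_of \<Theta>" "z \<noteq> 0" "fst z = 0"
  shows "exp (real CARD('m) / real CARD('n) * s) \<le> pbox_gauge s z"
proof -
  have "snd z \<in> int_vec" "snd z \<noteq> 0"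
    using assms by (auto simp: lattice_of_def prod_eq_iff)
  then show ?thesis
    using infnorm_int_vec_ge_1[of "snd z"] by (simp add: pbox_gauge_def le_max_iff_disj)
qed

text \<open>Either the first component is a nonzero integer vector or the second one is. This
  uniform bound keeps the successive minima positive, so that their logarithms can be
  handled.\<close>

lemma pbox_gauge_lattice_ge:
  fixes z :: "(real^'m) \<times> (real^'n)"
  assumes "z \<in> lattice_of \<Theta>" "z \<noteq> 0" "s \<ge> 0"
  shows "exp (- s) \<le> pbox_gauge s z"
proof (cases "fst z = 0")
  case True
  have "exp (- s) \<le> exp (real CARD('m) / real CARD('n) * s)"
    unfolding exp_le_cancel_iff by (rule order_trans[of _ 0]) (simp_all add: assms(3))
  then show ?thesis
    using pbox_gauge_ge_exp_if_fst_0[OF assms(1,2) True, of s] by linarith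
next
  case False
  have "fst z \<in> int_vec"
    using assms(1) by (auto simp: lattice_of_def)
  then show ?thesis
    using infnorm_int_vec_ge_1[of "fst z"] False by (simp add: pbox_gauge_def le_max_iff_disj)
qed

section \<open>The first two successive minima\<close>

lemma bdd_below_succ_min_set:
  "bdd_below {\<mu>::real. \<mu> > 0 \<and> P \<mu>}"
  by (rule bdd_belowI[of _ 0]) auto

lemma succ_min_le:
  assumes "\<mu> > 0" "S \<subseteq> L \<inter> (\<lambda>z. \<mu> *\<^sub>R z) ` K" "finite S" "card S = p" "independent S"
  shows "succ_min p K L \<le> \<mu>"
  unfolding succ_min_def using assms by (intro cInf_lower bdd_below_succ_min_set) auto

text \<open>The witness \<open>S\<close> makes the set of admissible factors nonempty, since the
  infimum of an empty set of reals carries no information. Each admissible factor is bounded below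
  because an independent set with \<open>p > 0\<close> elements contains a nonzero lattice
  point.\<close>

lemma succ_min_pbox_ge:
  fixes \<Theta> :: "real^'m^'n"
  assumes "p > 0" "s \<ge> 0" "\<mu> > 0" "finite S" "card S = p" "independent S"
    "S \<subseteq> lattice_of \<Theta> \<inter> (\<lambda>z. \<mu> *\<^sub>R z) ` pbox s"
  shows "exp (- s) \<le> succ_min p (pbox s) (lattice_of \<Theta>)"
  unfolding succ_min_def
proof (rule cInf_greatest)
  show "{\<mu>. \<mu> > 0 \<and> (\<exists>S. S \<subseteq> lattice_of \<Theta> \<inter> (\<lambda>z. \<mu> *\<^sub>R z) ` pbox s
      \<and> finite S \<and> card S = p \<and> independent S)} \<noteq> {}"
    using assms by blast
next
  fix \<nu> assume "\<nu> \<in> {\<mu>. \<mu> > 0 \<and> (\<exists>S. S \<subseteq> lattice_of \<Theta> \<inter> (\<lambda>z. \<mu> *\<^sub>R z) ` pbox s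
      \<and> finite S \<and> card S = p \<and> independent S)}"
  then obtain T where T: "\<nu> > 0" "T \<subseteq> lattice_of \<Theta> \<inter> (\<lambda>z. \<nu> *\<^sub>R z) ` pbox s"
    "card T = p" "independent T"
    by blast
  then obtain z where "z \<in> T" "z \<noteq> 0"
    using assms(1) dependent_zero by (metis all_not_in_conv card.empty less_irrefl)
  then show "exp (- s) \<le> \<nu>"
    using T pbox_gauge_lattice_ge[of z \<Theta> s] assms(2) mem_scaled_pbox_iff[of \<nu> z s] by force
qed

lemma succ_min_1_le_pbox_gauge:
  assumes "z \<in> lattice_of \<Theta>" "z \<noteq> 0" "s \<ge> 0"
  shows "succ_min 1 (pbox s) (lattice_of \<Theta>) \<le> pbox_gauge s z"
proof -
  have "pbox_gauge s z > 0"
    using pbox_gauge_lattice_ge[OF assms] exp_gt_zero order_less_le_trans by blast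
  then show ?thesis
    using assms by (intro succ_min_le[where S = "{z}"]) (auto simp: mem_scaled_pbox_iff)
qed

lemma lattice_point_fst_0:
  "(0, axis j 1) \<in> lattice_of \<Theta>"
  unfolding lattice_of_def
  by (auto simp: int_vec_def axis_def intro!: exI[of _ 0] exI[of _ "axis j 1"])

lemma lattice_nonzero_point:
  fixes \<Theta> :: "real^'m^'n"
  obtains z where "z \<in> lattice_of \<Theta>" "z \<noteq> 0"
  using lattice_point_fst_0[of undefined \<Theta>] by (metis axis_eq_0_iff one_neq_zero prod.inject zero_prod_def)

lemma succ_min_1_ge:
  fixes \<Theta> :: "real^'m^'n"
  assumes "s \<ge> 0"
  shows "exp (- s) \<le> succ_min 1 (pbox s) (lattice_of \<Theta>)"
proof -
  obtain z where z: "z \<in> lattice_of \<Theta>" "z \<noteq> 0"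
    using lattice_nonzero_point .
  have "pbox_gauge s z > 0"
    using pbox_gauge_lattice_ge[OF z assms] exp_gt_zero order_less_le_trans by blast
  then show ?thesis
    using z assms
    by (intro succ_min_pbox_ge[where S = "{z}" and \<mu> = "pbox_gauge s z"])
      (auto simp: mem_scaled_pbox_iff)
qed

text \<open>A definition by infimum yields points arbitrarily close to the minimum;
  \<open>z0\<close> shows that the infimum is taken over a nonempty set.\<close>

lemma succ_min_1_less_obtains:
  fixes \<Theta> :: "real^'m^'n"
  assumes "succ_min 1 (pbox s) (lattice_of \<Theta>) < \<mu>" "s \<ge> 0"
  obtains z where "z \<in> lattice_of \<Theta>" "z \<noteq> 0" "pbox_gauge s z < \<mu>"
proof -
  obtain z0 where z0: "z0 \<in> lattice_of \<Theta>" "z0 \<noteq> 0"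
    using lattice_nonzero_point .
  have "pbox_gauge s z0 > 0"
    using pbox_gauge_lattice_ge[OF z0 assms(2)] exp_gt_zero order_less_le_trans by blast
  then have "pbox_gauge s z0 \<in> {\<mu>. \<mu> > 0 \<and> (\<exists>S. S \<subseteq> lattice_of \<Theta> \<inter> (\<lambda>z. \<mu> *\<^sub>R z) ` pbox s
      \<and> finite S \<and> card S = 1 \<and> independent S)}"
    using z0 by (auto simp: mem_scaled_pbox_iff intro!: exI[of _ "{z0}"])
  then obtain \<nu> S where S: "\<nu> < \<mu>" "\<nu> > 0" "S \<subseteq> lattice_of \<Theta> \<inter> (\<lambda>z. \<nu> *\<^sub>R z) ` pbox s"
    "card S = 1" "independent S"
    using cInf_lessD[OF _ assms(1)[unfolded succ_min_def]] by blast
  obtain z where "S = {z}"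
    using S(4) card_1_singletonE by blast
  with S show ?thesis
    using that[of z] mem_scaled_pbox_iff[of \<nu> z s] by force
qed

text \<open>The pair \<open>{w, z}\<close> is admissible for \<mu>. The lower bound supplies the
  positivity required when passing to \<open>ln\<close>.\<close>

lemma succ_min_2_bounds:
  assumes "z \<in> lattice_of \<Theta>" "z \<noteq> 0" "w \<in> lattice_of \<Theta>" "w \<notin> span {z}" "s \<ge> 0"
    "pbox_gauge s z \<le> \<mu>" "pbox_gauge s w \<le> \<mu>"
  shows "exp (- s) \<le> succ_min 2 (pbox s) (lattice_of \<Theta>)"
    and "succ_min 2 (pbox s) (lattice_of \<Theta>) \<le> \<mu>"
proof -
  have \<mu>: "\<mu> > 0"
    using pbox_gauge_lattice_ge[OF assms(1,2,5)] assms(6) exp_gt_zero order_less_le_trans by blast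
  have "w \<noteq> z"
    using assms(4) span_base by blast
  then have S: "finite {w, z}" "card {w, z} = 2" "independent {w, z}"
    using assms(2,4) by (auto simp: independent_insert)
  have sub: "{w, z} \<subseteq> lattice_of \<Theta> \<inter> (\<lambda>z. \<mu> *\<^sub>R z) ` pbox s"
    using assms \<mu> by (auto simp: mem_scaled_pbox_iff)
  show "exp (- s) \<le> succ_min 2 (pbox s) (lattice_of \<Theta>)"
    using succ_min_pbox_ge[OF _ assms(5) \<mu> S sub] by simp
  show "succ_min 2 (pbox s) (lattice_of \<Theta>) \<le> \<mu>"
    using succ_min_le[OF \<mu> sub S] .
qed

section \<open>From gauges of lattice points to bounds on the exponents\<close>

lemma Psi_1: "Psi \<Theta> 1 s = ln (succ_min 1 (pbox s) (lattice_of \<Theta>)) / s"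
  by (simp add: Psi_def psi_def)

lemma Psi_1_ge:
  assumes "s > 0"
  shows "Psi \<Theta> 1 s \<ge> - 1"
proof -
  have "- s \<le> ln (succ_min 1 (pbox s) (lattice_of \<Theta>))"
    using succ_min_1_ge[of s \<Theta>] assms by (simp add: ln_ge_iff order_less_le_trans[OF exp_gt_zero])
  then show ?thesis
    unfolding Psi_1 using assms by (simp add: pos_le_divide_eq)
qed

lemma Psi_1_le:
  assumes "z \<in> lattice_of \<Theta>" "z \<noteq> 0" "s > 0" "pbox_gauge s z \<le> exp (q * s)"
  shows "Psi \<Theta> 1 s \<le> q"
proof -
  have pos: "0 < succ_min 1 (pbox s) (lattice_of \<Theta>)"
    using succ_min_1_ge[of s \<Theta>] assms(3) by (intro order_less_le_trans[OF exp_gt_zero]) auto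
  have "succ_min 1 (pbox s) (lattice_of \<Theta>) \<le> exp (q * s)"
    using succ_min_1_le_pbox_gauge[OF assms(1,2), of s] assms(3,4) by linarith
  then have "ln (succ_min 1 (pbox s) (lattice_of \<Theta>)) \<le> q * s"
    using pos by (metis ln_exp ln_mono)
  then show ?thesis
    unfolding Psi_1 using assms(3) by (simp add: pos_divide_le_eq)
qed

text \<open>The independent pair bounds the summand \<open>psi \<Theta> 2 s\<close> by
  \<open>q\<close>. Keeping \<open>Psi \<Theta> 1 s\<close> on the right allows it to be estimated
  separately.\<close>

lemma Psi_2_le:
  assumes "z \<in> lattice_of \<Theta>" "z \<noteq> 0" "w \<in> lattice_of \<Theta>" "w \<notin> span {z}" "s > 0"
    "pbox_gauge s z \<le> exp (q * s)" "pbox_gauge s w \<le> exp (q * s)"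
  shows "Psi \<Theta> 2 s \<le> Psi \<Theta> 1 s + q"
proof -
  note bounds = succ_min_2_bounds[OF assms(1-4) _ assms(6,7)]
  have pos: "0 < succ_min 2 (pbox s) (lattice_of \<Theta>)"
    using bounds(1) assms(5) by (intro order_less_le_trans[OF exp_gt_zero]) auto
  have "ln (succ_min 2 (pbox s) (lattice_of \<Theta>)) \<le> q * s"
    using bounds(2) assms(5) pos by (metis less_imp_le ln_exp ln_mono)
  then have "psi \<Theta> 2 s \<le> q"
    using assms(5) by (simp add: psi_def field_simps)
  moreover have "Psi \<Theta> 2 s = Psi \<Theta> 1 s + psi \<Theta> 2 s"
    by (simp add: Psi_def eval_nat_numeral)
  ultimately show ?thesis
    by simp
qed

text \<open>Simultaneous Dirichlet approximation to one column of \<Theta> gives a point whose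
  integer vector \<open>x\<close> lives on one coordinate. The exponent lies below m/n by 1/n, and
  this gap is what later arguments exploit.\<close>

lemma dirichlet_lattice_point:
  fixes \<Theta> :: "real^'m^'n"
  assumes "s \<ge> 0"
  obtains z where "z \<in> lattice_of \<Theta>" "z \<noteq> 0"
    "pbox_gauge s z \<le> 2 ^ CARD('n) * exp ((real CARD('m) - 1) / real CARD('n) * s)"
proof -
  define n where "n = CARD('n)"
  have n: "n > 0"
    by (simp add: n_def)
  \<comment> \<open>With this \<open>N\<close> the errors are at most \<open>exp (- s / n)\<close>,
    and the denominator is at most \<open>N ^ n\<close>, hence at most \<open>2 ^ n * exp s\<close>:
    rounding up a number that is at least 1 costs at most a factor 2.\<close>
  define N where "N = nat \<lceil>exp (s / real n)\<rceil>"
  have e1: "exp (s / real n) \<ge> 1"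
    using assms by simp
  have N_ge: "real N \<ge> exp (s / real n)"
    unfolding N_def by (rule real_nat_ceiling_ge)
  have N_le: "real N \<le> 2 * exp (s / real n)"
    using e1 unfolding N_def by linarith
  have "N > 0"
    using N_ge e1 by linarith
  \<comment> \<open>The approximation theorem numbers its targets by naturals below
    \<open>n\<close>; \<open>h\<close> transports them to the index type.\<close>
  obtain h :: "'n \<Rightarrow> nat" where h: "bij_betw h UNIV {0..<n}"
    using ex_bij_betw_finite_nat[of "UNIV :: 'n set"] by (auto simp: n_def)
  then have h_inv: "inv_into UNIV h (h k) = k" and h_less: "h k < n" for k
    by (auto simp: bij_betw_def inv_into_f_f)
  \<comment> \<open>An arbitrary column.\<close>
  define j :: 'm where "j = undefined"
  obtain q p where q: "0 < q" "q \<le> int (N ^ n)"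
    and qp: "\<And>i. i < n \<Longrightarrow> \<bar>of_int q * (\<Theta> $ inv_into UNIV h i $ j) - of_int (p i)\<bar> < 1 / real N"
    using Dirichlet_approx_simult[OF \<open>N > 0\<close>, of n "\<lambda>i. \<Theta> $ inv_into UNIV h i $ j"] by metis
  define x :: "real^'m" where "x = axis j (of_int q)"
  define y :: "real^'n" where "y = (\<chi> k. of_int (p (h k)))"
  have "x \<in> int_vec" "y \<in> int_vec"
    by (auto simp: int_vec_def x_def y_def axis_def)
  then have mem: "(x, y - \<Theta> *v x) \<in> lattice_of \<Theta>"
    by (auto simp: lattice_of_def)
  have "x \<noteq> 0"
    using q by (simp add: x_def axis_eq_0_iff)
  then have nz: "(x, y - \<Theta> *v x) \<noteq> 0"
    by (simp add: zero_prod_def)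
  have "(\<Theta> *v x) $ k = of_int q * (\<Theta> $ k $ j)" for k
    by (simp add: matrix_vector_mult_def x_def axis_def if_distrib sum.delta cong: if_cong)
  then have "\<bar>(y - \<Theta> *v x) $ k\<bar> \<le> 1 / real N" for k
    using qp[OF h_less[of k]] by (simp add: y_def h_inv abs_minus_commute)
  then have "infnorm (y - \<Theta> *v x) \<le> 1 / real N"
    by (simp add: infnorm_le_iff_cart)
  also have "\<dots> \<le> 1 / exp (s / real n)"
    using N_ge by (simp add: frac_le)
  finally have "infnorm (y - \<Theta> *v x) * exp (real CARD('m) / real n * s)
      \<le> 1 / exp (s / real n) * exp (real CARD('m) / real n * s)"
    by (rule mult_right_mono) simp
  also have "\<dots> = exp ((real CARD('m) - 1) / real n * s)"
    by (simp add: exp_diff[symmetric] diff_divide_distrib algebra_simps)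
  also have "\<dots> \<le> 2 ^ n * exp ((real CARD('m) - 1) / real n * s)"
    by simp
  finally have v: "infnorm (y - \<Theta> *v x) * exp (real CARD('m) / real n * s) \<le> \<dots>" .
  have "infnorm x \<le> of_int q"
    using q by (simp add: infnorm_le_iff_cart x_def axis_def)
  also have "\<dots> \<le> real N ^ n"
    using q(2) by (metis of_int_le_iff of_int_of_nat_eq of_nat_power)
  also have "\<dots> \<le> (2 * exp (s / real n)) ^ n"
    using N_le by (intro power_mono) auto
  also have "\<dots> = 2 ^ n * exp s"
    using n by (simp add: power_mult_distrib exp_of_nat_mult[symmetric])
  finally have "infnorm x * exp (- s) \<le> 2 ^ n"
    by (simp add: exp_minus divide_simps)
  \<comment> \<open>The exponent is nonnegative, since there is at least one column and
    \<open>s \<ge> 0\<close>.\<close>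
  also have "\<dots> \<le> 2 ^ n * exp ((real CARD('m) - 1) / real n * s)"
    using assms by (simp add: Suc_leI)
  finally have u: "infnorm x * exp (- s) \<le> \<dots>" .
  show ?thesis
    using u v by (intro that[OF mem nz]) (simp add: pbox_gauge_def n_def)
qed

section \<open>Constants absorbed into the exponent\<close>

lemma eventually_le_exp:
  fixes \<epsilon> :: real
  assumes "\<epsilon> > 0"
  shows "\<forall>\<^sub>F s in at_top. C \<le> exp (\<epsilon> * s)"
proof -
  have "filterlim (\<lambda>s. exp (\<epsilon> * s)) at_top at_top"
    using assms
    by (intro filterlim_compose[OF exp_at_top] filterlim_tendsto_pos_mult_at_top[OF tendsto_const])
      (auto simp: filterlim_ident)
  then show ?thesis
    by (simp add: filterlim_at_top)
qed

text \<open>Going forward from time 0 gives slope m/n and the constant factor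
  \<open>pbox_gauge 0 z\<close>, which \<open>exp (\<epsilon> * s)\<close> eventually
  dominates.\<close>

lemma eventually_pbox_gauge_le:
  fixes z :: "(real^'m) \<times> (real^'n)"
  assumes "\<epsilon> > 0"
  shows "\<forall>\<^sub>F s in at_top. pbox_gauge s z \<le> exp ((real CARD('m) / real CARD('n) + \<epsilon>) * s)"
proof -
  show ?thesis
    using eventually_le_exp[OF assms, of "pbox_gauge 0 z"] eventually_ge_at_top[of 0]
  proof eventually_elim
    case (elim s)
    have "pbox_gauge s z \<le> exp (real CARD('m) / real CARD('n) * s) * pbox_gauge 0 z"
      using pbox_gauge_forward[of 0 s z] elim by simp
    also have "\<dots> \<le> exp (real CARD('m) / real CARD('n) * s) * exp (\<epsilon> * s)"
      using elim by (intro mult_left_mono) auto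
    finally show ?case
      by (simp add: exp_add[symmetric] distrib_right)
  qed
qed

section \<open>Integer solutions\<close>

lemma of_int_scaleR_mem:
  fixes G :: "'a::real_vector set"
  assumes "0 \<in> G" "\<And>x y. x \<in> G \<Longrightarrow> y \<in> G \<Longrightarrow> x - y \<in> G" "g \<in> G"
  shows "of_int k *\<^sub>R g \<in> G"
proof (induction k rule: int_induct[where k = 0])
  case base
  then show ?case using assms(1) by simp
next
  case (step1 i)
  then have "of_int i *\<^sub>R g - (0 - g) \<in> G"
    using assms by blast
  then show ?case by (simp add: scaleR_add_left)
next
  case (step2 i)
  then have "of_int i *\<^sub>R g - g \<in> G"
    using assms by blast
  then show ?case by (simp add: scaleR_diff_left)
qed

text \<open>Division with remainder: choose \<open>g\<close> in \<open>G\<close> with the least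
  positive value of \<open>\<bar>\<phi> g\<bar>\<close>. Subtracting a suitable multiple of
  \<open>g\<close> from \<open>w\<close> leaves a remainder on which \<phi> vanishes, and on the
  line through \<open>g0\<close> only 0 has that property.\<close>

lemma is_lattice_of_dim_1I:
  fixes G :: "'a::real_vector set" and \<phi> :: "'a \<Rightarrow> real"
  assumes G: "0 \<in> G" "\<And>x y. x \<in> G \<Longrightarrow> y \<in> G \<Longrightarrow> x - y \<in> G"
    and \<phi>: "linear \<phi>" "\<And>x. x \<in> G \<Longrightarrow> \<phi> x \<in> \<int>"
    and g0: "g0 \<in> G" "\<phi> g0 \<noteq> 0" "G \<subseteq> span {g0}"
  shows "is_lattice_of_dim 1 G"
proof -
  interpret \<phi>: linear \<phi> by fact
  define P where "P n \<longleftrightarrow> n > 0 \<and> (\<exists>g\<in>G. \<bar>\<phi> g\<bar> = of_nat n)" for n :: nat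
  obtain k0 where "\<phi> g0 = of_int k0"
    using \<phi>(2)[OF g0(1)] by (auto elim: Ints_cases)
  then have "P (nat \<bar>k0\<bar>)"
    using g0 by (auto simp: P_def intro!: bexI[of _ g0])
  then obtain n where n: "P n" "\<And>n'. n' < n \<Longrightarrow> \<not> P n'"
    by (metis exists_least_iff)
  then obtain g where g: "g \<in> G" "\<bar>\<phi> g\<bar> = of_nat n" "n > 0"
    by (auto simp: P_def)
  obtain kg where kg: "\<phi> g = of_int kg"
    using \<phi>(2)[OF g(1)] by (auto elim: Ints_cases)
  have kg_n: "\<bar>kg\<bar> = int n"
    using g(2) kg by linarith
  have "\<exists>c. w = of_int c *\<^sub>R g" if w: "w \<in> G" for w
  proof -
    obtain kw where kw: "\<phi> w = of_int kw"
      using \<phi>(2)[OF w] by (auto elim: Ints_cases)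
    define r where "r = w - of_int (kw div kg) *\<^sub>R g"
    have r: "r \<in> G"
      unfolding r_def by (intro G w of_int_scaleR_mem g)
    have \<phi>r: "\<phi> r = of_int (kw mod kg)"
      by (simp add: r_def \<phi>.diff \<phi>.scale kw kg minus_div_mult_eq_mod[symmetric])
    have "\<bar>kw mod kg\<bar> < int n"
      using abs_mod_less[of kg kw] kg_n g(3) by simp
    then have "\<not> P (nat \<bar>kw mod kg\<bar>)"
      by (intro n(2)) linarith
    then have "\<phi> r = 0"
      using r \<phi>r by (auto simp: P_def)
    moreover obtain c where "r = c *\<^sub>R g0"
      using r g0(3) by (auto simp: span_singleton)
    ultimately have "r = 0"
      using g0(2) by (simp add: \<phi>.scale)
    then show ?thesis
      by (auto simp: r_def)
  qed
  moreover have "of_int c *\<^sub>R g \<in> G" for c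
    using of_int_scaleR_mem[OF G g(1)] .
  ultimately have "w \<in> G \<longleftrightarrow> (\<exists>c. w = of_int c *\<^sub>R g)" for w
    by blast
  \<comment> \<open>Coefficients in \<open>is_lattice_of_dim\<close> are functions on the whole
    type; for a single basis vector only the value at \<open>g\<close> matters.\<close>
  also have "(\<exists>c. w = of_int c *\<^sub>R g) \<longleftrightarrow> (\<exists>c :: 'a \<Rightarrow> int. w = of_int (c g) *\<^sub>R g)" for w
  proof
    assume "\<exists>c. w = of_int c *\<^sub>R g"
    then obtain c where "w = of_int c *\<^sub>R g" ..
    then show "\<exists>c :: 'a \<Rightarrow> int. w = of_int (c g) *\<^sub>R g"
      by (intro exI[of _ "\<lambda>_. c"])
  qed blast
  finally have "G = {\<Sum>b\<in>{g}. of_int (c b) *\<^sub>R b | c :: 'a \<Rightarrow> int. True}"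
    by simp blast
  moreover have "g \<noteq> 0"
    using g \<phi>.zero by auto
  ultimately show ?thesis
    unfolding is_lattice_of_dim_def by (intro exI[of _ "{g}"]) simp
qed

text \<open>Integer solutions \<open>(x, y)\<close> correspond to lattice points
  \<open>(x, 0)\<close>. If all solutions lay on one line through a nonzero solution, they would
  form a one-dimensional lattice.\<close>

lemma int_solutions_trivial_or_rank_ge_2:
  fixes \<Theta> :: "real^'m^'n"
  assumes "\<not> is_lattice_of_dim 1 (int_solutions \<Theta>)"
  obtains (trivial) "\<And>z. z \<in> lattice_of \<Theta> \<Longrightarrow> z \<noteq> 0 \<Longrightarrow> snd z \<noteq> 0"
  | (rank_ge_2) z w where "z \<in> lattice_of \<Theta>" "z \<noteq> 0" "w \<in> lattice_of \<Theta>" "w \<notin> span {z}"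
    "snd z = 0" "snd w = 0"
proof (cases "int_solutions \<Theta> \<subseteq> {0}")
  case True
  have "snd z \<noteq> 0" if z: "z \<in> lattice_of \<Theta>" "z \<noteq> 0" for z
  proof
    assume "snd z = 0"
    with z obtain x y where "z = (x, 0)" "x \<in> int_vec" "y \<in> int_vec" "y = \<Theta> *v x"
      by (auto simp: lattice_of_def)
    moreover from this have "(x, y) \<in> int_solutions \<Theta>"
      by (auto simp: int_solutions_def)
    ultimately show False
      using True z(2) by (auto simp: zero_prod_def)
  qed
  then show ?thesis
    using trivial by blast
next
  case False
  then obtain x0 y0 where g0: "(x0, y0) \<in> int_solutions \<Theta>" "(x0, y0) \<noteq> 0"
    by auto
  then have "x0 \<noteq> 0"
    by (auto simp: int_solutions_def zero_prod_def)
  then obtain i where i: "x0 $ i \<noteq> 0"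
    by (auto simp: vec_eq_iff)
  have "\<not> int_solutions \<Theta> \<subseteq> span {(x0, y0)}"
  proof
    assume "int_solutions \<Theta> \<subseteq> span {(x0, y0)}"
    \<comment> \<open>The \<open>i\<close>-th coordinate is integer valued on solutions and nonzero
      at \<open>(x0, y0)\<close>.\<close>
    then have "is_lattice_of_dim 1 (int_solutions \<Theta>)"
      using g0(1) i
      by (intro is_lattice_of_dim_1I[of _ "\<lambda>z. fst z $ i" "(x0, y0)"])
        (auto simp: int_solutions_def int_vec_def zero_prod_def matrix_vector_mult_diff_distrib
          intro!: linearI)
    with assms show False ..
  qed
  then obtain x y where w: "(x, y) \<in> int_solutions \<Theta>" "(x, y) \<notin> span {(x0, y0)}"
    by auto
  \<comment> \<open>Replacing \<open>y\<close> by 0 preserves independence because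
    \<open>y = \<Theta> *v x\<close> is linear in \<open>x\<close>.\<close>
  have "(x, 0) \<notin> span {(x0, 0 :: real^'n)}"
  proof
    assume "(x, 0) \<in> span {(x0, 0 :: real^'n)}"
    then obtain c where "x = c *\<^sub>R x0"
      by (auto simp: span_singleton)
    then have "(x, y) = c *\<^sub>R (x0, y0)"
      using w(1) g0(1) by (auto simp: int_solutions_def scalar_mult_eq_scaleR[symmetric] vector_scalar_commute)
    then show False
      using w(2) by (auto simp: span_singleton)
  qed
  moreover have "(x, 0) \<in> lattice_of \<Theta>" if "(x, y) \<in> int_solutions \<Theta>" for x y
    using that by (force simp: int_solutions_def lattice_of_def)
  ultimately show ?thesis
    using rank_ge_2[of "(x0, 0)" "(x, 0)"] w(1) g0(1) \<open>x0 \<noteq> 0\<close> by (auto simp: zero_prod_def)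
qed

text \<open>A point with first component zero and one with first component nonzero.\<close>

lemma lattice_independent_pair:
  fixes \<Theta> :: "real^'m^'n"
  obtains z w where "z \<in> lattice_of \<Theta>" "z \<noteq> 0" "w \<in> lattice_of \<Theta>" "w \<notin> span {z}"
proof -
  define x :: "real^'m" where "x = axis undefined 1"
  have x: "x \<in> int_vec" "x \<noteq> 0"
    by (simp add: x_def int_vec_def axis_def) (simp add: x_def axis_eq_0_iff)
  have "(x, 0 - \<Theta> *v x) \<in> lattice_of \<Theta>"
    unfolding lattice_of_def using x(1) by (fastforce simp: int_vec_def)
  moreover have "(x, 0 - \<Theta> *v x) \<notin> span {(0, axis undefined 1)}"
    using x(2) by (auto simp: span_singleton)
  ultimately show ?thesis
    using that[OF lattice_point_fst_0[of undefined \<Theta>], of "(x, 0 - \<Theta> *v x)"]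
    by (simp add: zero_prod_def axis_eq_0_iff)
qed

section \<open>Balanced lattice points\<close>

text \<open>Both \<open>exp (q * s)\<close> and \<open>2 * \<mu>\<close> exceed the first minimum
  \<mu>, so some point lies below both; the second bound makes it shortest up to a factor 2.\<close>

lemma Psi_1_less_obtains:
  assumes "Psi \<Theta> 1 s < q" "s > 0"
  obtains z where "z \<in> lattice_of \<Theta>" "z \<noteq> 0" "pbox_gauge s z < exp (q * s)"
    "\<And>w. w \<in> lattice_of \<Theta> \<Longrightarrow> w \<noteq> 0 \<Longrightarrow> pbox_gauge s z < 2 * pbox_gauge s w"
proof -
  define \<mu> where "\<mu> = succ_min 1 (pbox s) (lattice_of \<Theta>)"
  have pos: "\<mu> > 0"
    unfolding \<mu>_def using succ_min_1_ge[of s \<Theta>] assms(2)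
    by (intro order_less_le_trans[OF exp_gt_zero]) auto
  have "ln \<mu> < q * s"
    using assms unfolding Psi_1 \<mu>_def by (simp add: pos_divide_less_eq)
  then have "\<mu> < min (exp (q * s)) (2 * \<mu>)"
    using pos by (metis exp_less_mono exp_ln min_less_iff_conj mult_2 less_add_same_cancel1)
  then obtain z where "z \<in> lattice_of \<Theta>" "z \<noteq> 0" "pbox_gauge s z < min (exp (q * s)) (2 * \<mu>)"
    unfolding \<mu>_def using succ_min_1_less_obtains assms(2) by (metis less_imp_le)
  moreover have "\<mu> \<le> pbox_gauge s w" if "w \<in> lattice_of \<Theta>" "w \<noteq> 0" for w
    unfolding \<mu>_def using that assms(2) by (intro succ_min_1_le_pbox_gauge) auto
  ultimately show ?thesis
    using that[of z] by fastforce
qed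

text \<open>The factor 2 allows points that are only nearly shortest, so that the first minimum need
  not be known to be attained.\<close>

lemma not_in_span_if_gauge_le_half:
  assumes "z \<in> lattice_of \<Theta>" "z \<noteq> 0" "w \<in> lattice_of \<Theta>" "w \<noteq> 0" "s \<ge> 0" "t \<ge> 0"
    and z: "pbox_gauge s z < 2 * pbox_gauge s w"
    and w: "2 * pbox_gauge t w \<le> pbox_gauge t z"
  shows "w \<notin> span {z}"
proof
  assume "w \<in> span {z}"
  then obtain c where c: "w = c *\<^sub>R z"
    by (auto simp: span_singleton)
  have "pbox_gauge t z > 0" "pbox_gauge s z > 0"
    using pbox_gauge_lattice_ge[OF assms(1,2)] assms(5,6) exp_gt_zero order_less_le_trans by blast+
  \<comment> \<open>If \<open>w = c *\<^sub>R z\<close>, the ratio of the two gauges is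
    \<open>\<bar>c\<bar>\<close> at every time, so the comparisons at \<open>s\<close> and at
    \<open>t\<close> contradict each other.\<close>
  moreover have "(2 * \<bar>c\<bar>) * pbox_gauge t z \<le> 1 * pbox_gauge t z"
    "1 * pbox_gauge s z < (2 * \<bar>c\<bar>) * pbox_gauge s z"
    using z w by (simp_all add: c pbox_gauge_scaleR)
  ultimately have "2 * \<bar>c\<bar> \<le> 1" "1 < 2 * \<bar>c\<bar>"
    by (simp_all only: mult_le_cancel_right_pos mult_less_cancel_right_pos)
  then show False
    by linarith
qed

text \<open>The room between the upper exponent and \<open>q\<close> absorbs the factor 2 as soon as
  \<open>t \<ge> ln 2 / (q - q')\<close>.\<close>

lemma eventually_lattice_point_below:
  fixes \<Theta> :: "real^'m^'n"
  assumes "upper_schmidt \<Theta> 1 < ereal q"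
  shows "\<forall>\<^sub>F t in at_top. \<exists>w\<in>lattice_of \<Theta>. w \<noteq> 0 \<and> 2 * pbox_gauge t w < exp (q * t)"
proof -
  obtain q' where q': "upper_schmidt \<Theta> 1 < ereal q'" "q' < q"
    using ereal_dense2[OF assms] by auto
  have "\<forall>\<^sub>F t in at_top. Psi \<Theta> 1 t < q'"
    using Limsup_lessD[OF q'(1)[unfolded upper_schmidt_def]] by simp
  then show ?thesis
    using eventually_gt_at_top[of 0] eventually_ge_at_top[of "ln 2 / (q - q')"]
  proof eventually_elim
    case (elim t)
    obtain w where w: "w \<in> lattice_of \<Theta>" "w \<noteq> 0" "pbox_gauge t w < exp (q' * t)"
      using Psi_1_less_obtains[OF elim(1,2)] by blast
    have "ln 2 \<le> (q - q') * t"
      using elim(3) q'(2) by (simp add: pos_divide_le_eq mult.commute)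
    then have "2 \<le> exp ((q - q') * t)"
      by (metis exp_le_cancel_iff exp_ln zero_less_numeral)
    then have "2 * exp (q' * t) \<le> exp ((q - q') * t) * exp (q' * t)"
      by (intro mult_right_mono) auto
    also have "\<dots> = exp (q * t)"
      by (simp add: exp_add[symmetric] algebra_simps)
    finally show ?case
      using w by force
  qed
qed

text \<open>The point is nearly shortest at a late time \<open>s\<close> with
  \<open>Psi \<Theta> 1 s < q\<close>. The Dirichlet bound makes its second component small, which
  forces the balancing time \<sigma> to be late as well. Near minimality stays recorded at
  \<open>s\<close>, not at \<sigma>.\<close>

lemma balanced_lattice_point:
  fixes \<Theta> :: "real^'m^'n"
  defines "\<kappa> \<equiv> real CARD('m) / real CARD('n)"
  assumes triv: "\<And>z. z \<in> lattice_of \<Theta> \<Longrightarrow> z \<noteq> 0 \<Longrightarrow> snd z \<noteq> 0"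
    and less: "lower_schmidt \<Theta> 1 < ereal q" and "q \<le> \<kappa>"
  obtains \<sigma> s z where "\<sigma> \<ge> S" "\<sigma> > 0" "s \<ge> 0" "z \<in> lattice_of \<Theta>" "z \<noteq> 0"
    "infnorm (fst z) * exp (- \<sigma>) = infnorm (snd z) * exp (\<kappa> * \<sigma>)"
    "pbox_gauge \<sigma> z \<le> exp (q * \<sigma>)"
    "\<And>w. w \<in> lattice_of \<Theta> \<Longrightarrow> w \<noteq> 0 \<Longrightarrow> pbox_gauge s z < 2 * pbox_gauge s w"
proof -
  define n where "n = real CARD('n)"
  have n: "n > 0"
    by (simp add: n_def)
  have \<kappa>: "\<kappa> > 0"
    by (simp add: \<kappa>_def)
  have \<kappa>n: "(real CARD('m) - 1) / n = \<kappa> - 1 / n"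
    by (simp add: \<kappa>_def n_def diff_divide_distrib)
  \<comment> \<open>One factor 2 comes from near minimality, the power of 2 from the Dirichlet
    point.\<close>
  define C :: real where "C = 2 * 2 ^ CARD('n)"
  have C: "C > 1"
    unfolding C_def using one_le_power[of "2::real" "CARD('n)"] by linarith
  \<comment> \<open>Chosen so that \<open>s \<ge> S'\<close> yields
    \<open>ln C + (\<kappa> + 1) * max S 1 \<le> s / n\<close>, and from this
    \<open>\<sigma> \<ge> max S 1\<close>.\<close>
  define S' where "S' = n * (ln C + (\<kappa> + 1) * max S 1)"
  have "\<not> (\<forall>\<^sub>F s in at_top. ereal q \<le> ereal (Psi \<Theta> 1 s))"
    using Liminf_bounded less unfolding lower_schmidt_def by (metis leD)
  then obtain s where s: "s \<ge> max S' 1" "Psi \<Theta> 1 s < q"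
    unfolding eventually_at_top_linorder ereal_less_eq by (meson not_le)
  then have "s > 0" "S' / n \<le> s / n"
    using n by (simp_all add: divide_right_mono)
  then have S'_s: "ln C + (\<kappa> + 1) * max S 1 \<le> s / n"
    using n by (simp add: S'_def)
  obtain z where z: "z \<in> lattice_of \<Theta>" "z \<noteq> 0" "pbox_gauge s z < exp (q * s)"
    and short: "\<And>w. w \<in> lattice_of \<Theta> \<Longrightarrow> w \<noteq> 0 \<Longrightarrow> pbox_gauge s z < 2 * pbox_gauge s w"
    using Psi_1_less_obtains[OF s(2) \<open>s > 0\<close>] by blast
  obtain w where w: "w \<in> lattice_of \<Theta>" "w \<noteq> 0"
    "pbox_gauge s w \<le> 2 ^ CARD('n) * exp ((\<kappa> - 1 / n) * s)"
    using dirichlet_lattice_point[of s \<Theta>] s(1) \<kappa>n unfolding n_def by auto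
  have "pbox_gauge s z < C * exp ((\<kappa> - 1 / n) * s)"
    using short[OF w(1,2)] w(3) by (simp add: C_def)
  also have "\<dots> = exp (ln C + (\<kappa> - 1 / n) * s)"
    using C by (simp add: exp_add)
  finally have gauge_less: "pbox_gauge s z < exp (ln C + (\<kappa> - 1 / n) * s)" .
  have lnC_less: "ln C < s / n"
    using S'_s mult_pos_pos[of "\<kappa> + 1" "max S 1"] \<kappa> by linarith
  define A B where "A = infnorm (fst z)" and "B = infnorm (snd z)"
  have A_le: "A * exp (- s) \<le> pbox_gauge s z" and B_le: "B * exp (\<kappa> * s) \<le> pbox_gauge s z"
    by (simp_all add: pbox_gauge_def A_def B_def \<kappa>_def)
  \<comment> \<open>Otherwise the gauge is at least \<open>exp (\<kappa> * s)\<close>, which exceeds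
    the Dirichlet bound because \<open>ln C < s / n\<close>.\<close>
  have "fst z \<noteq> 0"
  proof
    assume "fst z = 0"
    then have "exp (\<kappa> * s) < exp (ln C + (\<kappa> - 1 / n) * s)"
      using pbox_gauge_ge_exp_if_fst_0[OF z(1,2), of s] gauge_less unfolding \<kappa>_def by linarith
    then show False
      using lnC_less by (simp add: left_diff_distrib)
  qed
  moreover have "fst z \<in> int_vec"
    using z(1) by (auto simp: lattice_of_def)
  ultimately have "A \<ge> 1"
    unfolding A_def by (intro infnorm_int_vec_ge_1)
  then have lnA: "ln A \<ge> 0" and A: "A * exp (- r) = exp (ln A - r)" for r
    by (simp_all add: exp_diff exp_minus divide_inverse)
  have "B > 0"
    using triv[OF z(1,2)] by (simp add: B_def infnorm_pos_lt)
  then have B: "B * exp r = exp (ln B + r)" for r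
    by (simp add: exp_add)
  have lnA_less: "ln A - s < q * s"
    using order_le_less_trans[OF A_le z(3)] by (simp add: A)
  have "exp (ln B + \<kappa> * s) \<le> pbox_gauge s z"
    using B_le by (simp add: B)
  then have "exp (ln B + \<kappa> * s) < exp (q * s)" "exp (ln B + \<kappa> * s) < exp (ln C + (\<kappa> - 1 / n) * s)"
    using z(3) gauge_less by linarith+
  then have lnB_less: "ln B + \<kappa> * s < q * s" "ln B < ln C - s / n"
    by (simp_all add: left_diff_distrib)
  \<comment> \<open>The solution of
    \<open>ln A - \<sigma> = ln B + \<kappa> * \<sigma>\<close>.\<close>
  define \<sigma> where "\<sigma> = (ln A - ln B) / (\<kappa> + 1)"
  have "max S 1 * (\<kappa> + 1) \<le> ln A - ln B"
    using lnA lnB_less(2) S'_s by (subst mult.commute) linarith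
  then have \<sigma>: "\<sigma> \<ge> max S 1"
    unfolding \<sigma>_def using \<kappa> by (intro mult_imp_le_div_pos) auto
  have "(\<kappa> + 1) * \<sigma> = ln A - ln B"
    using \<kappa> by (simp add: \<sigma>_def)
  then have eq: "ln A - \<sigma> = ln B + \<kappa> * \<sigma>"
    by (simp add: distrib_right)
  then have balanced: "A * exp (- \<sigma>) = B * exp (\<kappa> * \<sigma>)"
    and gauge: "pbox_gauge \<sigma> z = exp (ln A - \<sigma>)"
    by (simp_all add: A B pbox_gauge_def flip: A_def B_def \<kappa>_def)
  \<comment> \<open>For \<sigma> after \<open>s\<close> this follows from the first term and
    \<open>q \<ge> - 1\<close>; for \<sigma> before \<open>s\<close>, from the second term and
    \<open>q \<le> \<kappa>\<close>.\<close>
  have "ln A - \<sigma> \<le> q * \<sigma>"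
  proof (cases "s \<le> \<sigma>")
    case True
    have "0 \<le> (q + 1) * s"
      using lnA lnA_less by (simp add: distrib_right)
    then have "q + 1 \<ge> 0"
      using s(1) by (simp add: zero_le_mult_iff)
    then have "(q + 1) * s \<le> (q + 1) * \<sigma>"
      using True by (intro mult_left_mono)
    then show ?thesis
      using lnA_less by (simp add: distrib_right)
  next
    case False
    then have "(q - \<kappa>) * s \<le> (q - \<kappa>) * \<sigma>"
      using \<open>q \<le> \<kappa>\<close> by (intro mult_left_mono_neg) auto
    then show ?thesis
      using lnB_less(1) eq by (simp add: left_diff_distrib)
  qed
  then show ?thesis
    using that[of \<sigma> s z] \<sigma> s(1) z(1,2) balanced gauge short by (simp add: A_def B_def)
qed

section \<open>Bounding the second minimum at a balanced point\<close>

text \<open>The time \<open>t\<close> solves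
  \<open>\<psi> * \<sigma> + \<kappa> * (t - \<sigma>) = q * t\<close>: there the second term of
  \<open>z\<close> reaches \<open>exp (q * t)\<close>, so \<open>w\<close>, less than half as long,
  is independent of \<open>z\<close>. Carrying \<open>w\<close> back to \<sigma> costs at most
  \<open>exp (t - \<sigma>)\<close>.\<close>

lemma Psi_2_le_forward:
  fixes \<Theta> :: "real^'m^'n"
  defines "\<kappa> \<equiv> real CARD('m) / real CARD('n)"
  assumes z: "z \<in> lattice_of \<Theta>" "z \<noteq> 0" "\<sigma> > 0" "s \<ge> 0"
    "infnorm (fst z) * exp (- \<sigma>) = infnorm (snd z) * exp (\<kappa> * \<sigma>)"
    "pbox_gauge \<sigma> z = exp (\<psi> * \<sigma>)"
    and short: "\<And>w. w \<in> lattice_of \<Theta> \<Longrightarrow> w \<noteq> 0 \<Longrightarrow> pbox_gauge s z < 2 * pbox_gauge s w"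
    and q: "\<psi> \<le> q" "q < \<kappa>" and t: "t = \<sigma> * (\<kappa> - \<psi>) / (\<kappa> - q)"
    and w: "w \<in> lattice_of \<Theta>" "w \<noteq> 0" "2 * pbox_gauge t w < exp (q * t)"
  shows "Psi \<Theta> 2 \<sigma> \<le> 2 * \<psi> + (\<kappa> + 1) * (q - \<psi>) / (\<kappa> - q)"
proof -
  \<comment> \<open>The relative displacement \<open>(t - \<sigma>) / \<sigma>\<close>.\<close>
  define \<rho> where "\<rho> = (q - \<psi>) / (\<kappa> - q)"
  have \<rho>: "\<rho> \<ge> 0"
    using q by (simp add: \<rho>_def)
  have t_eq: "t = \<sigma> + \<rho> * \<sigma>"
    using q by (simp add: t \<rho>_def field_simps)
  have "q * (1 + \<rho>) = \<psi> + \<kappa> * \<rho>"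
    using q by (simp add: \<rho>_def field_simps)
  moreover have "q * t = q * (1 + \<rho>) * \<sigma>"
    by (simp add: t_eq algebra_simps)
  ultimately have "q * t = (\<psi> + \<kappa> * \<rho>) * \<sigma>"
    by (simp only:)
  then have qt: "q * t = \<psi> * \<sigma> + \<kappa> * (\<rho> * \<sigma>)"
    by (simp add: distrib_right)
  have "t \<ge> \<sigma>"
    using \<rho> z(3) by (simp add: t_eq)
  \<comment> \<open>By balance the gauge at \<sigma> equals its second term, whose logarithm grows
    with slope exactly \<kappa>.\<close>
  have "pbox_gauge \<sigma> z = infnorm (snd z) * exp (\<kappa> * \<sigma>)"
    using z(5) by (simp add: pbox_gauge_def \<kappa>_def)
  then have "infnorm (snd z) * exp (\<kappa> * t) = exp (\<psi> * \<sigma>) * exp (\<kappa> * (\<rho> * \<sigma>))"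
    using z(6) by (simp add: t_eq distrib_left exp_add mult.assoc)
  also have "\<dots> = exp (q * t)"
    by (simp add: qt exp_add)
  finally have "exp (q * t) \<le> pbox_gauge t z"
    by (simp add: pbox_gauge_def \<kappa>_def)
  then have indep: "w \<notin> span {z}"
    using not_in_span_if_gauge_le_half[OF z(1,2) w(1,2) z(4) _ short[OF w(1,2)], of t]
      w(3) z(3) \<open>t \<ge> \<sigma>\<close> by simp
  have "pbox_gauge \<sigma> w \<le> exp (t - \<sigma>) * pbox_gauge t w"
    using \<open>t \<ge> \<sigma>\<close> by (rule pbox_gauge_backward)
  also have "\<dots> \<le> exp (t - \<sigma>) * exp (q * t)"
    using w(3) exp_gt_zero[of "q * t"] by (intro mult_left_mono) (linarith, simp)
  \<comment> \<open>The factor \<open>\<kappa> + 1\<close> collects the growth of \<open>z\<close>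
    up to \<open>t\<close> and the cost of the way back for \<open>w\<close>.\<close>
  also have "\<dots> = exp ((\<psi> + (\<kappa> + 1) * \<rho>) * \<sigma>)"
    by (simp only: qt exp_add[symmetric]) (simp add: t_eq algebra_simps)
  finally have gw: "pbox_gauge \<sigma> w \<le> \<dots>" .
  have "\<psi> \<le> \<psi> + (\<kappa> + 1) * \<rho>"
    using \<rho> by (simp add: \<kappa>_def)
  then have gz: "pbox_gauge \<sigma> z \<le> exp ((\<psi> + (\<kappa> + 1) * \<rho>) * \<sigma>)"
    using z(3,6) by (simp add: mult_right_mono)
  have "Psi \<Theta> 2 \<sigma> \<le> Psi \<Theta> 1 \<sigma> + (\<psi> + (\<kappa> + 1) * \<rho>)"
    by (rule Psi_2_le[OF z(1,2) w(1) indep z(3) gz gw])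
  moreover have "Psi \<Theta> 1 \<sigma> \<le> \<psi>"
    using z by (intro Psi_1_le) auto
  ultimately show ?thesis
    by (simp add: \<rho>_def)
qed

text \<open>The mirror image: \<open>t\<close> solves
  \<open>\<psi> * \<sigma> + (\<sigma> - t) = q * t\<close>, reached backwards along the first term
  of \<open>z\<close>. Carrying \<open>w\<close> forward to \<sigma> costs at most
  \<open>exp (\<kappa> * (\<sigma> - t))\<close>.\<close>

lemma Psi_2_le_backward:
  fixes \<Theta> :: "real^'m^'n"
  defines "\<kappa> \<equiv> real CARD('m) / real CARD('n)"
  assumes z: "z \<in> lattice_of \<Theta>" "z \<noteq> 0" "\<sigma> > 0" "s \<ge> 0"
    "infnorm (fst z) * exp (- \<sigma>) = infnorm (snd z) * exp (\<kappa> * \<sigma>)"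
    "pbox_gauge \<sigma> z = exp (\<psi> * \<sigma>)"
    and short: "\<And>w. w \<in> lattice_of \<Theta> \<Longrightarrow> w \<noteq> 0 \<Longrightarrow> pbox_gauge s z < 2 * pbox_gauge s w"
    and q: "\<psi> \<le> q" "\<psi> \<ge> - 1" "q > - 1" and t: "t = \<sigma> * (1 + \<psi>) / (1 + q)"
    and w: "w \<in> lattice_of \<Theta>" "w \<noteq> 0" "2 * pbox_gauge t w < exp (q * t)"
  shows "Psi \<Theta> 2 \<sigma> \<le> 2 * \<psi> + (\<kappa> + 1) * (q - \<psi>) / (1 + q)"
proof -
  define \<rho> where "\<rho> = (q - \<psi>) / (1 + q)"
  have \<rho>: "\<rho> \<ge> 0"
    using q by (simp add: \<rho>_def)
  have t_eq: "t = \<sigma> - \<rho> * \<sigma>"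
    using q by (simp add: t \<rho>_def field_simps)
  have "q * (1 - \<rho>) = \<psi> + \<rho>"
    using q by (simp add: \<rho>_def field_simps)
  moreover have "q * t = q * (1 - \<rho>) * \<sigma>"
    by (simp add: t_eq algebra_simps)
  ultimately have "q * t = (\<psi> + \<rho>) * \<sigma>"
    by (simp only:)
  then have qt: "q * t = \<psi> * \<sigma> + \<rho> * \<sigma>"
    by (simp add: distrib_right)
  have "t \<le> \<sigma>"
    using \<rho> z(3) by (simp add: t_eq)
  \<comment> \<open>The comparison of gauges at \<open>t\<close> requires a nonnegative time; this
    is where \<open>\<psi> \<ge> - 1\<close> enters.\<close>
  have "t \<ge> 0"
    using q z(3) by (simp add: t)
  have "pbox_gauge \<sigma> z = infnorm (fst z) * exp (- \<sigma>)"
    using z(5) by (simp add: pbox_gauge_def \<kappa>_def)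
  then have "infnorm (fst z) * exp (- t) = exp (\<psi> * \<sigma>) * exp (\<rho> * \<sigma>)"
    using z(6) by (simp add: t_eq exp_diff exp_minus divide_simps)
  also have "\<dots> = exp (q * t)"
    by (simp add: qt exp_add)
  finally have "exp (q * t) \<le> pbox_gauge t z"
    by (simp add: pbox_gauge_def)
  then have indep: "w \<notin> span {z}"
    using not_in_span_if_gauge_le_half[OF z(1,2) w(1,2) z(4) _ short[OF w(1,2)], of t]
      w(3) z(3) \<open>t \<ge> 0\<close> by simp
  have "pbox_gauge \<sigma> w \<le> exp (\<kappa> * (\<sigma> - t)) * pbox_gauge t w"
    unfolding \<kappa>_def using \<open>t \<le> \<sigma>\<close> by (rule pbox_gauge_forward)
  also have "\<dots> \<le> exp (\<kappa> * (\<sigma> - t)) * exp (q * t)"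
    using w(3) exp_gt_zero[of "q * t"] by (intro mult_left_mono) (linarith, simp)
  also have "\<dots> = exp ((\<psi> + (\<kappa> + 1) * \<rho>) * \<sigma>)"
    by (simp only: qt exp_add[symmetric]) (simp add: t_eq algebra_simps)
  finally have gw: "pbox_gauge \<sigma> w \<le> \<dots>" .
  have "\<psi> \<le> \<psi> + (\<kappa> + 1) * \<rho>"
    using \<rho> by (simp add: \<kappa>_def)
  then have gz: "pbox_gauge \<sigma> z \<le> exp ((\<psi> + (\<kappa> + 1) * \<rho>) * \<sigma>)"
    using z(3,6) by (simp add: mult_right_mono)
  have "Psi \<Theta> 2 \<sigma> \<le> Psi \<Theta> 1 \<sigma> + (\<psi> + (\<kappa> + 1) * \<rho>)"
    by (rule Psi_2_le[OF z(1,2) w(1) indep z(3) gz gw])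
  moreover have "Psi \<Theta> 1 \<sigma> \<le> \<psi>"
    using z by (intro Psi_1_le) auto
  ultimately show ?thesis
    by (simp add: \<rho>_def)
qed

section \<open>Passing to the limit\<close>

text \<open>A larger lower limit would keep \<open>f\<close> eventually above some
  \<open>y > R0\<close>, while \<open>R \<epsilon> < y\<close> for small \<epsilon> gives
  arbitrarily late values of \<open>f\<close> below \<open>y\<close>. All losses in \<epsilon> are
  thus removed in one limit.\<close>

lemma Liminf_le_if_tendsto_at_right:
  fixes f R :: "real \<Rightarrow> real"
  assumes R: "(R \<longlongrightarrow> R0) (at_right 0)"
    and le: "\<forall>\<^sub>F \<epsilon> in at_right 0. \<forall>S. \<exists>\<sigma>\<ge>S. f \<sigma> \<le> R \<epsilon>"
  shows "Liminf at_top (\<lambda>s. ereal (f s)) \<le> ereal R0"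
proof (rule ccontr)
  assume "\<not> ?thesis"
  then obtain y where y: "ereal R0 < ereal y" "ereal y < Liminf at_top (\<lambda>s. ereal (f s))"
    by (metis ereal_dense2 not_le)
  have "\<forall>\<^sub>F s in at_top. y < f s"
    using less_LiminfD[OF y(2)] by simp
  then obtain S where S: "\<And>s. s \<ge> S \<Longrightarrow> y < f s"
    unfolding eventually_at_top_linorder by blast
  have "\<forall>\<^sub>F \<epsilon> in at_right 0. R \<epsilon> < y"
    using order_tendstoD(2)[OF R] y(1) by simp
  with le have "\<forall>\<^sub>F \<epsilon> in at_right (0::real). False"
  proof eventually_elim
    case (elim \<epsilon>)
    then obtain \<sigma> where "\<sigma> \<ge> S" "f \<sigma> \<le> R \<epsilon>"
      by blast
    with S elim(2) show ?case
      by (meson less_trans not_le)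
  qed
  then show False
    by simp
qed

text \<open>Half of the Dirichlet gap 1/n absorbs the constant factor and the other half gives
  strictness, which makes the denominator \<open>m - n * b\<close> positive.\<close>

lemma upper_schmidt_1_less:
  fixes \<Theta> :: "real^'m^'n"
  shows "upper_schmidt \<Theta> 1 < ereal (real CARD('m) / real CARD('n))"
proof -
  define n where "n = real CARD('n)"
  define \<kappa> where "\<kappa> = real CARD('m) / real CARD('n)"
  have n: "n > 0"
    by (simp add: n_def)
  have \<kappa>n: "(real CARD('m) - 1) / n = \<kappa> - 1 / n"
    by (simp add: \<kappa>_def n_def diff_divide_distrib)
  define C :: real where "C = 2 ^ CARD('n)"
  have "C > 0"
    by (simp add: C_def)
  have "\<forall>\<^sub>F s in at_top. ereal (Psi \<Theta> 1 s) \<le> ereal (\<kappa> - 1 / (2 * n))"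
    using eventually_gt_at_top[of 0] eventually_ge_at_top[of "2 * n * ln C"]
  proof eventually_elim
    case (elim s)
    obtain z where z: "z \<in> lattice_of \<Theta>" "z \<noteq> 0" "pbox_gauge s z \<le> C * exp ((\<kappa> - 1 / n) * s)"
      using dirichlet_lattice_point[of s \<Theta>] elim \<kappa>n unfolding n_def C_def by auto
    have "ln C \<le> s / (2 * n)"
      using elim n by (simp add: pos_le_divide_eq mult.commute)
    then have "C \<le> exp (s / (2 * n))"
      using \<open>C > 0\<close> by (metis exp_le_cancel_iff exp_ln)
    then have "C * exp ((\<kappa> - 1 / n) * s) \<le> exp (s / (2 * n)) * exp ((\<kappa> - 1 / n) * s)"
      by (intro mult_right_mono) auto
    also have "\<dots> = exp ((\<kappa> - 1 / (2 * n)) * s)"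
    proof -
      have "s / (2 * n) = 1 / (2 * n) * s" "1 / n = 2 * (1 / (2 * n))"
        by simp_all
      then show ?thesis
        by (simp only: exp_add[symmetric]) (simp add: algebra_simps)
    qed
    finally show ?case
      using Psi_1_le[OF z(1,2) elim(1)] z(3) by simp
  qed
  then have "upper_schmidt \<Theta> 1 \<le> ereal (\<kappa> - 1 / (2 * n))"
    unfolding upper_schmidt_def by (rule Limsup_bounded)
  also have "\<dots> < ereal \<kappa>"
    using n by simp
  finally show ?thesis
    by (simp add: \<kappa>_def)
qed

lemma lower_schmidt_1_ge: "lower_schmidt \<Theta> 1 \<ge> ereal (- 1)"
proof -
  have "\<forall>\<^sub>F s in at_top. ereal (- 1) \<le> ereal (Psi \<Theta> 1 s)"
    using eventually_gt_at_top[of 0] by eventually_elim (use Psi_1_ge in simp)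
  then show ?thesis
    unfolding lower_schmidt_def by (rule Liminf_bounded)
qed

text \<open>Squeezed between -1 and m/n, both exponents are finite, so the remaining arithmetic
  takes place in the reals.\<close>

lemma schmidt_1_real:
  fixes \<Theta> :: "real^'m^'n"
  obtains a b where "lower_schmidt \<Theta> 1 = ereal a" "upper_schmidt \<Theta> 1 = ereal b"
    "- 1 \<le> a" "a \<le> b" "b < real CARD('m) / real CARD('n)"
proof -
  have "lower_schmidt \<Theta> 1 \<le> upper_schmidt \<Theta> 1"
    unfolding lower_schmidt_def upper_schmidt_def by (rule Liminf_le_Limsup) simp
  with lower_schmidt_1_ge[of \<Theta>] upper_schmidt_1_less[of \<Theta>] show ?thesis
    by (cases "lower_schmidt \<Theta> 1"; cases "upper_schmidt \<Theta> 1") (auto intro: that)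
qed

text \<open>The exponent \<psi> of \<open>z\<close> at \<sigma> is at least
  \<open>Psi \<Theta> 1 \<sigma>\<close>, which exceeds \<open>p\<close> once \<sigma> is late.
  Hence \<psi> is confined from both sides.\<close>

lemma balanced_lattice_point_between:
  fixes \<Theta> :: "real^'m^'n"
  defines "\<kappa> \<equiv> real CARD('m) / real CARD('n)"
  assumes triv: "\<And>z. z \<in> lattice_of \<Theta> \<Longrightarrow> z \<noteq> 0 \<Longrightarrow> snd z \<noteq> 0"
    and p: "ereal p < lower_schmidt \<Theta> 1" and q: "lower_schmidt \<Theta> 1 < ereal q" "q \<le> \<kappa>"
  obtains \<sigma> s z \<psi> where "\<sigma> \<ge> S" "p < \<psi>" "\<psi> \<le> q"
    "z \<in> lattice_of \<Theta>" "z \<noteq> 0" "\<sigma> > 0" "s \<ge> 0"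
    "infnorm (fst z) * exp (- \<sigma>) = infnorm (snd z) * exp (\<kappa> * \<sigma>)"
    "pbox_gauge \<sigma> z = exp (\<psi> * \<sigma>)"
    "\<And>w. w \<in> lattice_of \<Theta> \<Longrightarrow> w \<noteq> 0 \<Longrightarrow> pbox_gauge s z < 2 * pbox_gauge s w"
proof -
  have "\<forall>\<^sub>F s in at_top. p < Psi \<Theta> 1 s"
    using less_LiminfD[OF p[unfolded lower_schmidt_def]] by simp
  then obtain S1 where S1: "\<And>s. s \<ge> S1 \<Longrightarrow> p < Psi \<Theta> 1 s"
    unfolding eventually_at_top_linorder by blast
  obtain \<sigma> s z where \<sigma>: "\<sigma> \<ge> max S S1" and z: "\<sigma> > 0" "s \<ge> 0" "z \<in> lattice_of \<Theta>" "z \<noteq> 0"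
    "infnorm (fst z) * exp (- \<sigma>) = infnorm (snd z) * exp (\<kappa> * \<sigma>)"
    "pbox_gauge \<sigma> z \<le> exp (q * \<sigma>)"
    "\<And>w. w \<in> lattice_of \<Theta> \<Longrightarrow> w \<noteq> 0 \<Longrightarrow> pbox_gauge s z < 2 * pbox_gauge s w"
    by (rule balanced_lattice_point[OF triv q(1) q(2)[unfolded \<kappa>_def], of "max S S1", folded \<kappa>_def])
      (assumption | rule that)+
  define \<psi> where "\<psi> = ln (pbox_gauge \<sigma> z) / \<sigma>"
  have "pbox_gauge \<sigma> z > 0"
    using pbox_gauge_lattice_ge[OF z(3,4)] z(1) exp_gt_zero order_less_le_trans less_imp_le by metis
  then have gauge: "pbox_gauge \<sigma> z = exp (\<psi> * \<sigma>)"
    using z(1) by (simp add: \<psi>_def)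
  moreover have "\<psi> \<le> q"
    using z(1,6) unfolding gauge by simp
  moreover have "p < \<psi>"
    using S1[of \<sigma>] \<sigma> Psi_1_le[OF z(3,4,1)] gauge by fastforce
  ultimately show ?thesis
    using that[of \<sigma> \<psi> z s] \<sigma> z by simp
qed

lemma lower_schmidt_2_le_forward:
  fixes \<Theta> :: "real^'m^'n"
  defines "\<kappa> \<equiv> real CARD('m) / real CARD('n)"
  assumes triv: "\<And>z. z \<in> lattice_of \<Theta> \<Longrightarrow> z \<noteq> 0 \<Longrightarrow> snd z \<noteq> 0"
    and ab: "lower_schmidt \<Theta> 1 = ereal a" "upper_schmidt \<Theta> 1 = ereal b" "a \<le> b" "b < \<kappa>"
  shows "lower_schmidt \<Theta> 2 \<le> ereal (2 * a + (\<kappa> + 1) * (b - a) / (\<kappa> - b))"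
  unfolding lower_schmidt_def
proof (rule Liminf_le_if_tendsto_at_right)
  \<comment> \<open>The worst ends of \<open>a - \<epsilon> < \<psi> \<le> a + \<epsilon>\<close>
    are used: the upper one in \<open>2 * \<psi>\<close>, the lower one in the numerator.\<close>
  let ?R = "\<lambda>\<epsilon>. 2 * (a + \<epsilon>) + (\<kappa> + 1) * ((b + \<epsilon>) - (a - \<epsilon>)) / (\<kappa> - (b + \<epsilon>))"
  show "(?R \<longlongrightarrow> 2 * a + (\<kappa> + 1) * (b - a) / (\<kappa> - b)) (at_right 0)"
    using ab(4) by (auto intro!: tendsto_eq_intros)
  have "\<forall>\<^sub>F \<epsilon> in at_right 0. \<epsilon> > 0 \<and> \<epsilon> < \<kappa> - b"
    unfolding eventually_at_right_field using ab(4) by (intro exI[of _ "\<kappa> - b"]) auto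
  then show "\<forall>\<^sub>F \<epsilon> in at_right 0. \<forall>S. \<exists>\<sigma>\<ge>S. Psi \<Theta> 2 \<sigma> \<le> ?R \<epsilon>"
  proof eventually_elim
    case (elim \<epsilon>)
    have pq: "ereal (a - \<epsilon>) < lower_schmidt \<Theta> 1" "lower_schmidt \<Theta> 1 < ereal (a + \<epsilon>)"
      "a + \<epsilon> \<le> real CARD('m) / real CARD('n)"
      using ab elim by (simp_all add: \<kappa>_def)
    show ?case
    proof
      fix S
      obtain T where T: "\<And>t. t \<ge> T \<Longrightarrow> \<exists>w\<in>lattice_of \<Theta>. w \<noteq> 0 \<and> 2 * pbox_gauge t w < exp ((b + \<epsilon>) * t)"
        using eventually_lattice_point_below[of \<Theta> "b + \<epsilon>"] ab(2) elim
        unfolding eventually_at_top_linorder by auto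
      obtain \<sigma> s z \<psi> where \<sigma>: "\<sigma> \<ge> max S T" and \<psi>: "a - \<epsilon> < \<psi>" "\<psi> \<le> a + \<epsilon>"
        and z: "z \<in> lattice_of \<Theta>" "z \<noteq> 0" "\<sigma> > 0" "s \<ge> 0"
          "infnorm (fst z) * exp (- \<sigma>) = infnorm (snd z) * exp (\<kappa> * \<sigma>)"
          "pbox_gauge \<sigma> z = exp (\<psi> * \<sigma>)"
        and short: "\<And>w. w \<in> lattice_of \<Theta> \<Longrightarrow> w \<noteq> 0 \<Longrightarrow> pbox_gauge s z < 2 * pbox_gauge s w"
        by (rule balanced_lattice_point_between[OF triv pq, of "max S T", folded \<kappa>_def])
          (assumption | rule that)+
      have q: "\<psi> \<le> b + \<epsilon>" "b + \<epsilon> < \<kappa>"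
        using \<psi> ab elim by auto
      define t where "t = \<sigma> * (\<kappa> - \<psi>) / (\<kappa> - (b + \<epsilon>))"
      \<comment> \<open>The forward time is no earlier than \<sigma>, hence beyond
        \<open>T\<close>.\<close>
      have "\<sigma> * (\<kappa> - (b + \<epsilon>)) \<le> \<sigma> * (\<kappa> - \<psi>)"
        using q z(3) by (intro mult_left_mono) auto
      then have "t \<ge> \<sigma>"
        unfolding t_def using q(2) by (intro mult_imp_le_div_pos) auto
      then obtain w where w: "w \<in> lattice_of \<Theta>" "w \<noteq> 0" "2 * pbox_gauge t w < exp ((b + \<epsilon>) * t)"
        using T[of t] \<sigma> by auto
      have "Psi \<Theta> 2 \<sigma> \<le> 2 * \<psi> + (\<kappa> + 1) * ((b + \<epsilon>) - \<psi>) / (\<kappa> - (b + \<epsilon>))"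
        unfolding \<kappa>_def
        by (rule Psi_2_le_forward[OF z(1-4) _ z(6) short q(1) _ _ w])
          (use z(5) q(2) in \<open>simp_all add: t_def \<kappa>_def\<close>)
      also have "\<dots> \<le> ?R \<epsilon>"
        using \<psi> q(2) by (intro add_mono divide_right_mono mult_left_mono) (auto simp: \<kappa>_def)
      finally show "\<exists>\<sigma>\<ge>S. Psi \<Theta> 2 \<sigma> \<le> ?R \<epsilon>"
        using \<sigma> by auto
    qed
  qed
qed

lemma lower_schmidt_2_le_backward:
  fixes \<Theta> :: "real^'m^'n"
  defines "\<kappa> \<equiv> real CARD('m) / real CARD('n)"
  assumes triv: "\<And>z. z \<in> lattice_of \<Theta> \<Longrightarrow> z \<noteq> 0 \<Longrightarrow> snd z \<noteq> 0"
    and ab: "lower_schmidt \<Theta> 1 = ereal a" "upper_schmidt \<Theta> 1 = ereal b" "- 1 < a" "a \<le> b" "b < \<kappa>"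
  shows "lower_schmidt \<Theta> 2 \<le> ereal (2 * a + (\<kappa> + 1) * (b - a) / (1 + b))"
  unfolding lower_schmidt_def
proof (rule Liminf_le_if_tendsto_at_right)
  let ?R = "\<lambda>\<epsilon>. 2 * (a + \<epsilon>) + (\<kappa> + 1) * ((b + \<epsilon>) - (a - \<epsilon>)) / (1 + (b + \<epsilon>))"
  show "(?R \<longlongrightarrow> 2 * a + (\<kappa> + 1) * (b - a) / (1 + b)) (at_right 0)"
    using ab(3,4) by (auto intro!: tendsto_eq_intros)
  have "\<forall>\<^sub>F \<epsilon> in at_right 0. \<epsilon> > 0 \<and> \<epsilon> < \<kappa> - b \<and> \<epsilon> < 1 + a"
    unfolding eventually_at_right_field using ab(3,5)
    by (intro exI[of _ "min (\<kappa> - b) (1 + a)"]) auto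
  then show "\<forall>\<^sub>F \<epsilon> in at_right 0. \<forall>S. \<exists>\<sigma>\<ge>S. Psi \<Theta> 2 \<sigma> \<le> ?R \<epsilon>"
  proof eventually_elim
    case (elim \<epsilon>)
    have pq: "ereal (a - \<epsilon>) < lower_schmidt \<Theta> 1" "lower_schmidt \<Theta> 1 < ereal (a + \<epsilon>)"
      "a + \<epsilon> \<le> real CARD('m) / real CARD('n)"
      using ab elim by (simp_all add: \<kappa>_def)
    show ?case
    proof
      fix S
      \<comment> \<open>A positive lower bound for \<open>1 + \<psi>\<close>, available because
        \<open>\<epsilon> < 1 + a\<close>. The backward time may precede \<sigma>, so \<sigma> is
        taken beyond \<open>T * (1 + (b + \<epsilon>)) / p\<close> to ensure
        \<open>t \<ge> T\<close>.\<close>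
      define p where "p = 1 + (a - \<epsilon>)"
      have p: "p > 0" and pos: "1 + (b + \<epsilon>) > 0"
        using ab elim by (auto simp: p_def)
      obtain T where T: "\<And>t. t \<ge> T \<Longrightarrow> \<exists>w\<in>lattice_of \<Theta>. w \<noteq> 0 \<and> 2 * pbox_gauge t w < exp ((b + \<epsilon>) * t)"
        using eventually_lattice_point_below[of \<Theta> "b + \<epsilon>"] ab(2) elim
        unfolding eventually_at_top_linorder by auto
      obtain \<sigma> s z \<psi> where \<sigma>: "\<sigma> \<ge> max S (T * (1 + (b + \<epsilon>)) / p)"
        and \<psi>: "a - \<epsilon> < \<psi>" "\<psi> \<le> a + \<epsilon>"
        and z: "z \<in> lattice_of \<Theta>" "z \<noteq> 0" "\<sigma> > 0" "s \<ge> 0"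
          "infnorm (fst z) * exp (- \<sigma>) = infnorm (snd z) * exp (\<kappa> * \<sigma>)"
          "pbox_gauge \<sigma> z = exp (\<psi> * \<sigma>)"
        and short: "\<And>w. w \<in> lattice_of \<Theta> \<Longrightarrow> w \<noteq> 0 \<Longrightarrow> pbox_gauge s z < 2 * pbox_gauge s w"
        by (rule balanced_lattice_point_between[OF triv pq,
              of "max S (T * (1 + (b + \<epsilon>)) / p)", folded \<kappa>_def])
          (assumption | rule that)+
      have q: "\<psi> \<le> b + \<epsilon>" "\<psi> \<ge> - 1" "b + \<epsilon> > - 1"
        using \<psi> ab elim by auto
      define t where "t = \<sigma> * (1 + \<psi>) / (1 + (b + \<epsilon>))"
      have "T * (1 + (b + \<epsilon>)) / p \<le> \<sigma>"
        using \<sigma> by simp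
      then have "T * (1 + (b + \<epsilon>)) \<le> \<sigma> * p"
        using p by (simp only: pos_divide_le_eq)
      also have "\<dots> \<le> \<sigma> * (1 + \<psi>)"
        using \<psi> z(3) by (intro mult_left_mono) (auto simp: p_def)
      finally have "t \<ge> T"
        unfolding t_def using pos by (intro mult_imp_le_div_pos)
      then obtain w where w: "w \<in> lattice_of \<Theta>" "w \<noteq> 0" "2 * pbox_gauge t w < exp ((b + \<epsilon>) * t)"
        using T[of t] by auto
      have "Psi \<Theta> 2 \<sigma> \<le> 2 * \<psi> + (\<kappa> + 1) * ((b + \<epsilon>) - \<psi>) / (1 + (b + \<epsilon>))"
        unfolding \<kappa>_def
        by (rule Psi_2_le_backward[OF z(1-4) _ z(6) short q _ w])
          (use z(5) in \<open>simp_all add: t_def \<kappa>_def\<close>)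
      also have "\<dots> \<le> ?R \<epsilon>"
        using \<psi> pos by (intro add_mono divide_right_mono mult_left_mono) (auto simp: \<kappa>_def)
      finally show "\<exists>\<sigma>\<ge>S. Psi \<Theta> 2 \<sigma> \<le> ?R \<epsilon>"
        using \<sigma> by auto
    qed
  qed
qed

text \<open>If the lower exponent is \<open>-1\<close>, the times \<open>t\<close> entering the backward bound need not tend to
  infinity; the following weaker bound then suffices.\<close>

lemma lower_schmidt_2_le_lower_schmidt_1:
  fixes \<Theta> :: "real^'m^'n"
  defines "\<kappa> \<equiv> real CARD('m) / real CARD('n)"
  assumes a: "lower_schmidt \<Theta> 1 = ereal a"
  shows "lower_schmidt \<Theta> 2 \<le> ereal (a + \<kappa>)"
  unfolding lower_schmidt_def
proof (rule Liminf_le_if_tendsto_at_right)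
  show "((\<lambda>\<epsilon>. (a + \<epsilon>) + (\<kappa> + \<epsilon>)) \<longlongrightarrow> a + \<kappa>) (at_right 0)"
    by (auto intro!: tendsto_eq_intros)
  \<comment> \<open>Any fixed independent pair has gauges growing with exponent at most
    \<open>\<kappa> + \<epsilon>\<close>, which bounds the second summand.\<close>
  obtain z w where zw: "z \<in> lattice_of \<Theta>" "z \<noteq> 0" "w \<in> lattice_of \<Theta>" "w \<notin> span {z}"
    using lattice_independent_pair .
  show "\<forall>\<^sub>F \<epsilon> in at_right 0. \<forall>S. \<exists>\<sigma>\<ge>S. Psi \<Theta> 2 \<sigma> \<le> (a + \<epsilon>) + (\<kappa> + \<epsilon>)"
    using eventually_at_right_less[of 0]
  proof eventually_elim
    case (elim \<epsilon>)
    have "\<forall>\<^sub>F s in at_top. Psi \<Theta> 2 s \<le> Psi \<Theta> 1 s + (\<kappa> + \<epsilon>)"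
      using eventually_pbox_gauge_le[OF elim, of z] eventually_pbox_gauge_le[OF elim, of w]
        eventually_gt_at_top[of 0]
      by eventually_elim (use Psi_2_le[OF zw] in \<open>simp add: \<kappa>_def\<close>)
    then obtain T where T: "\<And>s. s \<ge> T \<Longrightarrow> Psi \<Theta> 2 s \<le> Psi \<Theta> 1 s + (\<kappa> + \<epsilon>)"
      unfolding eventually_at_top_linorder by blast
    have "\<not> (\<forall>\<^sub>F s in at_top. ereal (a + \<epsilon>) \<le> ereal (Psi \<Theta> 1 s))"
    proof
      assume "\<forall>\<^sub>F s in at_top. ereal (a + \<epsilon>) \<le> ereal (Psi \<Theta> 1 s)"
      then have "ereal (a + \<epsilon>) \<le> lower_schmidt \<Theta> 1"
        unfolding lower_schmidt_def by (rule Liminf_bounded)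
      with a elim show False
        by simp
    qed
    then have *: "\<exists>s\<ge>S. Psi \<Theta> 1 s < a + \<epsilon>" for S
      unfolding eventually_at_top_linorder ereal_less_eq by (meson not_le)
    show ?case
    proof
      fix S
      obtain s where "s \<ge> max S T" "Psi \<Theta> 1 s < a + \<epsilon>"
        using *[of "max S T"] by blast
      then show "\<exists>\<sigma>\<ge>S. Psi \<Theta> 2 \<sigma> \<le> (a + \<epsilon>) + (\<kappa> + \<epsilon>)"
        using T[of s] by (intro exI[of _ s]) auto
    qed
  qed
qed

text \<open>A point with second component zero has gauge \<open>infnorm (fst z) * exp (- s)\<close>,
  of exponent -1; each of the two independent points contributes this much.\<close>

lemma schmidt_if_rank_ge_2:
  assumes "z \<in> lattice_of \<Theta>" "z \<noteq> 0" "w \<in> lattice_of \<Theta>" "w \<notin> span {z}" "snd z = 0" "snd w = 0"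
  shows "upper_schmidt \<Theta> 1 \<le> ereal (- 1)" "lower_schmidt \<Theta> 2 \<le> ereal (- 2)"
proof -
  have small: "\<forall>\<^sub>F s in at_top. pbox_gauge s x \<le> exp ((- 1 + \<epsilon>) * s)" if "\<epsilon> > 0" "snd x = 0" for x and \<epsilon> :: real
  proof -
    show ?thesis
      using eventually_le_exp[OF that(1), of "infnorm (fst x)"]
    proof eventually_elim
      case (elim s)
      have "infnorm (fst x) * exp (- s) \<le> exp (\<epsilon> * s) * exp (- s)"
        using elim by (intro mult_right_mono) auto
      also have "\<dots> = exp ((- 1 + \<epsilon>) * s)"
        by (simp add: exp_add[symmetric] algebra_simps)
      finally show ?case
        using that(2) by (simp add: pbox_gauge_def infnorm_0)
    qed
  qed
  have 1: "\<forall>\<^sub>F s in at_top. Psi \<Theta> 1 s \<le> - 1 + \<epsilon>" if "\<epsilon> > 0" for \<epsilon>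
    using small[OF that assms(5)] eventually_gt_at_top[of 0]
    by eventually_elim (use Psi_1_le[OF assms(1,2)] in simp)
  have 2: "\<forall>\<^sub>F s in at_top. Psi \<Theta> 2 s \<le> Psi \<Theta> 1 s + (- 1 + \<epsilon>)" if "\<epsilon> > 0" for \<epsilon>
    using small[OF that assms(5)] small[OF that assms(6)] eventually_gt_at_top[of 0]
    by eventually_elim (use Psi_2_le[OF assms(1-4)] in simp)
  show "upper_schmidt \<Theta> 1 \<le> ereal (- 1)"
  proof (rule ereal_le_epsilon2)
    fix \<epsilon> :: real assume "\<epsilon> > 0"
    have "\<forall>\<^sub>F s in at_top. ereal (Psi \<Theta> 1 s) \<le> ereal (- 1 + \<epsilon>)"
      using 1[OF \<open>\<epsilon> > 0\<close>] by simp
    then show "upper_schmidt \<Theta> 1 \<le> ereal (- 1) + ereal \<epsilon>"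
      unfolding upper_schmidt_def plus_ereal.simps by (rule Limsup_bounded)
  qed
  show "lower_schmidt \<Theta> 2 \<le> ereal (- 2)"
  proof (rule ereal_le_epsilon2)
    fix \<epsilon> :: real assume "\<epsilon> > 0"
    then have "\<epsilon> / 2 > 0"
      by simp
    have "\<forall>\<^sub>F s in at_top. ereal (Psi \<Theta> 2 s) \<le> ereal (- 2 + \<epsilon>)"
      using 1[OF \<open>\<epsilon> / 2 > 0\<close>] 2[OF \<open>\<epsilon> / 2 > 0\<close>] by eventually_elim simp
    then show "lower_schmidt \<Theta> 2 \<le> ereal (- 2) + ereal \<epsilon>"
      unfolding lower_schmidt_def plus_ereal.simps by (rule Liminf_le[OF trivial_limit_at_top_linorder])
  qed
qed

section \<open>The case distinction on the rank of the integer solutions\<close>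

theorem theorem4:
  fixes \<Theta> :: "real^'m^'n"
  assumes "CARD('n) + CARD('m) \<ge> 3"
    and "\<not> is_lattice_of_dim 1 (int_solutions \<Theta>)"
  shows "(upper_schmidt \<Theta> 1 \<noteq> -1 \<longrightarrow>
           lower_schmidt \<Theta> 2 \<le> 2 * lower_schmidt \<Theta> 1 +
             ereal (real (CARD('m) + CARD('n))) *
               ((upper_schmidt \<Theta> 1 - lower_schmidt \<Theta> 1) /
                (ereal (real CARD('n)) + ereal (real CARD('n)) * upper_schmidt \<Theta> 1))) \<and>
         lower_schmidt \<Theta> 2 \<le> 2 * lower_schmidt \<Theta> 1 +
           ereal (real (CARD('m) + CARD('n))) *
             ((upper_schmidt \<Theta> 1 - lower_schmidt \<Theta> 1) /
              (ereal (real CARD('m)) - ereal (real CARD('n)) * upper_schmidt \<Theta> 1))"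
proof -
  define m where "m = real CARD('m)"
  define n where "n = real CARD('n)"
  define \<kappa> where "\<kappa> = m / n"
  have n: "n > 0" and m: "m > 0" and d: "real (CARD('m) + CARD('n)) = m + n"
    by (simp_all add: m_def n_def)
  obtain a b where ab: "lower_schmidt \<Theta> 1 = ereal a" "upper_schmidt \<Theta> 1 = ereal b"
    "- 1 \<le> a" "a \<le> b" "b < \<kappa>"
    using schmidt_1_real[of \<Theta>] unfolding \<kappa>_def m_def n_def by blast
  have pos: "m - n * b > 0"
    using ab(5) n by (simp add: \<kappa>_def pos_less_divide_eq mult.commute)
  have two: "(2 :: ereal) = ereal 2"
    by simp
  \<comment> \<open>A nonzero denominator makes division in \<open>ereal\<close> agree with division
    of reals.\<close>
  have rhs: "2 * ereal a + ereal (m + n) * ((ereal b - ereal a) / ereal x)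
      = ereal (2 * a + (m + n) * ((b - a) / x))" if "x \<noteq> 0" for x
    unfolding two using that by simp
  have concl: ?thesis
    if 1: "b \<noteq> - 1 \<Longrightarrow> lower_schmidt \<Theta> 2 \<le> ereal (2 * a + (m + n) * ((b - a) / (n + n * b)))"
      and 2: "lower_schmidt \<Theta> 2 \<le> ereal (2 * a + (m + n) * ((b - a) / (m - n * b)))"
  proof (intro conjI impI)
    assume "upper_schmidt \<Theta> 1 \<noteq> - 1"
    then have "b \<noteq> - 1"
      using ab(2) by (auto simp: one_ereal_def)
    then have "n + n * b \<noteq> 0"
      using n mult_eq_0_iff[of n "1 + b"] by (simp add: distrib_left)
    then show "lower_schmidt \<Theta> 2 \<le> 2 * lower_schmidt \<Theta> 1 +
             ereal (real (CARD('m) + CARD('n))) *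
               ((upper_schmidt \<Theta> 1 - lower_schmidt \<Theta> 1) /
                (ereal (real CARD('n)) + ereal (real CARD('n)) * upper_schmidt \<Theta> 1))"
      unfolding ab d n_def[symmetric] times_ereal.simps plus_ereal.simps
      using 1[OF \<open>b \<noteq> - 1\<close>] rhs by simp
  next
    show "lower_schmidt \<Theta> 2 \<le> 2 * lower_schmidt \<Theta> 1 +
           ereal (real (CARD('m) + CARD('n))) *
             ((upper_schmidt \<Theta> 1 - lower_schmidt \<Theta> 1) /
              (ereal (real CARD('m)) - ereal (real CARD('n)) * upper_schmidt \<Theta> 1))"
      unfolding ab d n_def[symmetric] m_def[symmetric] times_ereal.simps ereal_minus
      using 2 rhs pos by simp
  qed
  from assms(2) show ?thesis
  proof (cases rule: int_solutions_trivial_or_rank_ge_2)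
    case trivial
    \<comment> \<open>Multiplying numerator and denominator by \<open>n\<close> removes
      \<kappa>.\<close>
    have f1: "(\<kappa> + 1) * (b - a) / (\<kappa> - b) = (m + n) * ((b - a) / (m - n * b))"
    proof -
      have "\<kappa> + 1 = (m + n) / n" "\<kappa> - b = (m - n * b) / n"
        using n by (simp_all add: \<kappa>_def field_simps)
      then show ?thesis
        using n by simp
    qed
    have f2: "(\<kappa> + 1) * (b - a) / (1 + b) = (m + n) * ((b - a) / (n + n * b))"
    proof -
      have "\<kappa> + 1 = (m + n) / n" "n + n * b = n * (1 + b)"
        using n by (simp_all add: \<kappa>_def field_simps)
      then show ?thesis
        using n by simp
    qed
    show ?thesis
    proof (rule concl)
      show "lower_schmidt \<Theta> 2 \<le> ereal (2 * a + (m + n) * ((b - a) / (m - n * b)))"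
        using lower_schmidt_2_le_forward[OF trivial ab(1,2,4)] ab(5) f1
        by (simp add: \<kappa>_def m_def n_def)
    next
      assume "b \<noteq> - 1"
      show "lower_schmidt \<Theta> 2 \<le> ereal (2 * a + (m + n) * ((b - a) / (n + n * b)))"
      proof (cases "a = - 1")
        \<comment> \<open>Here \<open>(b - a) / (1 + b) = 1\<close>, so the claimed bound becomes
          \<open>a + \<kappa>\<close>.\<close>
        case True
        then have "1 + b \<noteq> 0"
          using \<open>b \<noteq> - 1\<close> by linarith
        then have "(\<kappa> + 1) * (b - a) / (1 + b) = \<kappa> + 1"
          using True by (simp add: add.commute)
        then have eq: "2 * a + (m + n) * ((b - a) / (n + n * b)) = a + \<kappa>"
          using True f2 by linarith
        show ?thesis
          unfolding eq using lower_schmidt_2_le_lower_schmidt_1[OF ab(1)]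
          by (simp add: \<kappa>_def m_def n_def)
      next
        case False
        then show ?thesis
          using lower_schmidt_2_le_backward[OF trivial ab(1,2) _ ab(4)] ab(3,5) f2
          by (simp add: \<kappa>_def m_def n_def)
      qed
    qed
  next
    case (rank_ge_2 z w)
    have "b \<le> - 1" "lower_schmidt \<Theta> 2 \<le> ereal (- 2)"
      using schmidt_if_rank_ge_2[OF rank_ge_2] ab(2) by simp_all
    \<comment> \<open>With both exponents equal to -1, the first inequality is vacuous and the right
      side of the second is -2.\<close>
    moreover from this have "a = - 1" "b = - 1"
      using ab(3,4) by linarith+
    ultimately show ?thesis
      by (intro concl) simp_all
  qed
qed

end
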